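(* Let $A$ be a $C^*$-algebra, let $I \subseteq A$ be a (two-sided, not necessarily norm-closed) ideal, and let $J \subseteq A$ be a one-sided (left or right) ideal that is radical over $I$. Then $J \subseteq \sqrt{I}$. In particular, $\operatorname{Nil}_*(A/I) = \operatorname{Nil}^*(A/I)$.
   Context: $C^*$-algebras are not assumed unital, and $A/I$ is regarded as a (not necessarily unital) ring. An ideal in a ring $R$ (in particular in a $C^*$-algebra) is an additive subgroup $L \subseteq R$ with $aL \cup La \subseteq L$ for all $a \in R$; one-sided ideals are defined analogously. They are not assumed norm-closed or closed under complex scalars. For ideals $L,L'$, $LL'$ is the additive subgroup generated by $\{xy : x \in L, y \in L'\}$. An ideal $P$ in a ring $R$ is prime if $P \neq R$ and for all ideals $L,L' \subseteq R$, $LL' \subseteq P$ implies $L \subseteq P$ or $L' \subseteq P$. The semiprime closure $\sqrt{I}$ of an ideal $I \subseteq R$ is the intersection of all prime ideals of $R$ containing $I$, with $\sqrt{I} = R$ if there are none. A one-sided ideal $J \subseteq A$ is radical over $I$ if for every $x \in J$ there exists $n \geq 1$ with $x^n \in I$. For a ring $R$, the lower nilradical (prime radical) is $\operatorname{Nil}_*(R) := \sqrt{0}$, the semiprime closure of the zero ideal, and the upper nilradical $\operatorname{Nil}^*(R)$ is the unique largest nil two-sided ideal of $R$, where an ideal is nil if each of its elements is nilpotent. *)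

theory Defs
  imports "HOL-Analysis.Analysis" "HOL-Algebra.QuotRing" "HOL-Algebra.Generated_Groups"
begin

section \<open>Rings without identity\<close>

text \<open>
  The locale \<^locale>\<open>Ring.ring\<close> demands an identity, so non-unital rings get a locale of their own.
  They are carried by the same records; the field \<^const>\<open>one\<close> is meaningless and is never used.
\<close>

locale nonunital_ring = abelian_group R for R (structure) +
  assumes mult_closed: "x \<in> carrier R \<Longrightarrow> y \<in> carrier R \<Longrightarrow> x \<otimes> y \<in> carrier R"
    and mult_assoc: "x \<in> carrier R \<Longrightarrow> y \<in> carrier R \<Longrightarrow> z \<in> carrier R \<Longrightarrow>
      (x \<otimes> y) \<otimes> z = x \<otimes> (y \<otimes> z)"
    and distrib_r: "x \<in> carrier R \<Longrightarrow> y \<in> carrier R \<Longrightarrow> z \<in> carrier R \<Longrightarrow>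
      (x \<oplus> y) \<otimes> z = x \<otimes> z \<oplus> y \<otimes> z"
    and distrib_l: "x \<in> carrier R \<Longrightarrow> y \<in> carrier R \<Longrightarrow> z \<in> carrier R \<Longrightarrow>
      z \<otimes> (x \<oplus> y) = z \<otimes> x \<oplus> z \<otimes> y"

definition left_ideal :: "'a set \<Rightarrow> ('a, 'b) ring_scheme \<Rightarrow> bool"
  where "left_ideal L R \<longleftrightarrow>
    additive_subgroup L R \<and> (\<forall>a \<in> carrier R. \<forall>x \<in> L. a \<otimes>\<^bsub>R\<^esub> x \<in> L)"

definition right_ideal :: "'a set \<Rightarrow> ('a, 'b) ring_scheme \<Rightarrow> bool"
  where "right_ideal L R \<longleftrightarrow>
    additive_subgroup L R \<and> (\<forall>a \<in> carrier R. \<forall>x \<in> L. x \<otimes>\<^bsub>R\<^esub> a \<in> L)"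

definition two_sided_ideal :: "'a set \<Rightarrow> ('a, 'b) ring_scheme \<Rightarrow> bool"
  where "two_sided_ideal L R \<longleftrightarrow> left_ideal L R \<and> right_ideal L R"

definition ideal_product :: "('a, 'b) ring_scheme \<Rightarrow> 'a set \<Rightarrow> 'a set \<Rightarrow> 'a set"
  where "ideal_product R L L' = generate (add_monoid R) {x \<otimes>\<^bsub>R\<^esub> y | x y. x \<in> L \<and> y \<in> L'}"

definition prime_ideal :: "'a set \<Rightarrow> ('a, 'b) ring_scheme \<Rightarrow> bool"
  where "prime_ideal P R \<longleftrightarrow>
    two_sided_ideal P R \<and> P \<noteq> carrier R \<and>
    (\<forall>L L'. two_sided_ideal L R \<and> two_sided_ideal L' R \<and> ideal_product R L L' \<subseteq> P \<longrightarrow>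
      L \<subseteq> P \<or> L' \<subseteq> P)"

text \<open>Intersecting with the carrier only matters if no prime ideal contains \<open>I\<close>.\<close>

definition semiprime_closure :: "('a, 'b) ring_scheme \<Rightarrow> 'a set \<Rightarrow> 'a set"
  where "semiprime_closure R I = carrier R \<inter> \<Inter>{P. prime_ideal P R \<and> I \<subseteq> P}"

text \<open>
  The power \<open>x\<^sup>n\<close> for \<open>n \<ge> 1\<close>, by iterated right multiplication starting from \<open>x\<close>.
  The library's \<open>x [^] n\<close> starts from \<^const>\<open>one\<close>. The value at \<open>n = 0\<close> is junk.
\<close>

definition pos_pow :: "('a, 'b) ring_scheme \<Rightarrow> 'a \<Rightarrow> nat \<Rightarrow> 'a"
  where "pos_pow R x n = ((\<lambda>y. y \<otimes>\<^bsub>R\<^esub> x) ^^ (n - 1)) x"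

definition radical_over :: "('a, 'b) ring_scheme \<Rightarrow> 'a set \<Rightarrow> 'a set \<Rightarrow> bool"
  where "radical_over R J I \<longleftrightarrow> (\<forall>x \<in> J. \<exists>n \<ge> 1. pos_pow R x n \<in> I)"

definition nil_ideal :: "'a set \<Rightarrow> ('a, 'b) ring_scheme \<Rightarrow> bool"
  where "nil_ideal N R \<longleftrightarrow>
    two_sided_ideal N R \<and> (\<forall>x \<in> N. \<exists>n \<ge> 1. pos_pow R x n = \<zero>\<^bsub>R\<^esub>)"

definition lower_nilradical :: "('a, 'b) ring_scheme \<Rightarrow> 'a set"
  where "lower_nilradical R = semiprime_closure R {\<zero>\<^bsub>R\<^esub>}"

text \<open>Largest with respect to inclusion; existence is \<open>upper_nilradical_greatest\<close> below.\<close>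

definition upper_nilradical :: "('a, 'b) ring_scheme \<Rightarrow> 'a set"
  where "upper_nilradical R = (GREATEST N. nil_ideal N R)"

lemma pos_pow_1: "pos_pow R x (Suc 0) = x"
  by (simp add: pos_pow_def)

lemma pos_pow_Suc: "n \<ge> 1 \<Longrightarrow> pos_pow R x (Suc n) = pos_pow R x n \<otimes>\<^bsub>R\<^esub> x"
  by (cases n) (auto simp: pos_pow_def)

context nonunital_ring
begin

lemma pos_pow_closed: "n \<ge> 1 \<Longrightarrow> x \<in> carrier R \<Longrightarrow> pos_pow R x n \<in> carrier R"
  by (induction n rule: dec_induct) (auto simp: pos_pow_1 pos_pow_Suc mult_closed)

lemma zero_mult: "x \<in> carrier R \<Longrightarrow> \<zero> \<otimes> x = \<zero>"
  using distrib_r[of \<zero> \<zero> x] by (simp add: mult_closed)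

lemma mult_zero: "x \<in> carrier R \<Longrightarrow> x \<otimes> \<zero> = \<zero>"
  using distrib_l[of \<zero> \<zero> x] by (simp add: mult_closed)

lemma minus_mult: "x \<in> carrier R \<Longrightarrow> y \<in> carrier R \<Longrightarrow> (\<ominus> x) \<otimes> y = \<ominus> (x \<otimes> y)"
  by (rule minus_equality[symmetric]) (simp_all add: mult_closed zero_mult l_neg flip: distrib_r)

lemma mult_minus: "x \<in> carrier R \<Longrightarrow> y \<in> carrier R \<Longrightarrow> x \<otimes> (\<ominus> y) = \<ominus> (x \<otimes> y)"
  by (rule minus_equality[symmetric]) (simp_all add: mult_closed mult_zero l_neg flip: distrib_l)

lemma pos_pow_add:
  assumes "m \<ge> 1" "n \<ge> 1" "x \<in> carrier R"
  shows "pos_pow R x (m + n) = pos_pow R x m \<otimes> pos_pow R x n"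
  using assms(2,1,3)
  by (induction n rule: dec_induct) (auto simp: pos_pow_1 pos_pow_Suc mult_assoc pos_pow_closed)

lemma pos_pow_mult:
  assumes "m \<ge> 1" "n \<ge> 1" "x \<in> carrier R"
  shows "pos_pow R x (m * n) = pos_pow R (pos_pow R x m) n"
  using assms(2,1,3)
proof (induction n rule: dec_induct)
  case (step n)
  have "pos_pow R x (m * Suc n) = pos_pow R x (m * n + m)"
    by (simp add: add.commute)
  with step show ?case
    by (simp only: pos_pow_Suc, subst pos_pow_add) auto
qed (auto simp: pos_pow_1)


lemma two_sided_idealD:
  assumes "two_sided_ideal L R"
  shows "additive_subgroup L R" "L \<subseteq> carrier R" "\<zero> \<in> L"
    and "\<And>x y. x \<in> L \<Longrightarrow> y \<in> L \<Longrightarrow> x \<oplus> y \<in> L" "\<And>x. x \<in> L \<Longrightarrow> \<ominus> x \<in> L"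
    and "\<And>a x. a \<in> carrier R \<Longrightarrow> x \<in> L \<Longrightarrow> a \<otimes> x \<in> L"
    and "\<And>a x. a \<in> carrier R \<Longrightarrow> x \<in> L \<Longrightarrow> x \<otimes> a \<in> L"
proof -
  show *: "additive_subgroup L R"
    using assms by (simp add: two_sided_ideal_def left_ideal_def)
  interpret additive_subgroup L R by (rule *)
  show "L \<subseteq> carrier R" "\<zero> \<in> L" "\<And>x y. x \<in> L \<Longrightarrow> y \<in> L \<Longrightarrow> x \<oplus> y \<in> L"
    by (simp_all add: a_subset)
  show "\<And>x. x \<in> L \<Longrightarrow> \<ominus> x \<in> L"
    using abelian_group_axioms a_inv_closed by blast
qed (use assms in \<open>auto simp: two_sided_ideal_def left_ideal_def right_ideal_def\<close>)

lemma pos_pow_ideal: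
  assumes "two_sided_ideal L R" "x \<in> L" "n \<ge> 1"
  shows "pos_pow R x n \<in> L"
proof -
  have "x \<in> carrier R" using assms two_sided_idealD by blast
  with assms(3) show ?thesis
    by (induction n rule: dec_induct)
       (auto simp: pos_pow_1 pos_pow_Suc assms intro: two_sided_idealD(7)[OF assms(1)])
qed

lemma pos_pow_mod_ideal:
  assumes L: "two_sided_ideal L R" and x: "x \<in> carrier R" and y: "y \<in> L" and n: "n \<ge> 1"
  shows "\<exists>z \<in> L. pos_pow R (x \<oplus> y) n = pos_pow R x n \<oplus> z"
  using n
proof (induction n rule: dec_induct)
  case base
  then show ?case using y by (auto simp: pos_pow_1)
next
  case (step n)
  note D = two_sided_idealD[OF L]
  from step obtain z where z: "z \<in> L" "pos_pow R (x \<oplus> y) n = pos_pow R x n \<oplus> z" by blast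
  let ?p = "pos_pow R x n"
  have p: "?p \<in> carrier R" using step x by (intro pos_pow_closed) auto
  have c: "y \<in> carrier R" "z \<in> carrier R" using D y z by auto
  have "pos_pow R (x \<oplus> y) (Suc n) = (?p \<oplus> z) \<otimes> (x \<oplus> y)"
    using step z by (simp add: pos_pow_Suc)
  also have "\<dots> = ?p \<otimes> x \<oplus> (?p \<otimes> y \<oplus> z \<otimes> (x \<oplus> y))"
    using p c x by (simp add: distrib_r distrib_l mult_closed a_assoc a_lcomm)
  also have "?p \<otimes> x = pos_pow R x (Suc n)"
    using step by (simp add: pos_pow_Suc)
  finally show ?case
    using p c x y z by (intro bexI[of _ "?p \<otimes> y \<oplus> z \<otimes> (x \<oplus> y)"]) (auto intro: D(4,6,7))
qed

lemma two_sided_ideal_sum: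
  assumes L: "two_sided_ideal L R" and L': "two_sided_ideal L' R"
  shows "two_sided_ideal (set_add R L L') R"
proof -
  note D = two_sided_idealD[OF L] and D' = two_sided_idealD[OF L']
  have "additive_subgroup (set_add R L L') R"
    by (rule add_additive_subgroups[OF D(1) D'(1)])
  moreover have "a \<otimes> x \<in> set_add R L L' \<and> x \<otimes> a \<in> set_add R L L'"
    if a: "a \<in> carrier R" and x: "x \<in> set_add R L L'" for a x
  proof -
    from x obtain u v where uv: "u \<in> L" "v \<in> L'" "x = u \<oplus> v"
      by (auto simp: set_add_def')
    then have "u \<in> carrier R" "v \<in> carrier R" using D(2) D'(2) by auto
    then have "a \<otimes> x = a \<otimes> u \<oplus> a \<otimes> v" "x \<otimes> a = u \<otimes> a \<oplus> v \<otimes> a"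
      using uv a by (simp_all add: distrib_l distrib_r)
    moreover have "a \<otimes> u \<in> L" "u \<otimes> a \<in> L" "a \<otimes> v \<in> L'" "v \<otimes> a \<in> L'"
      using D(6,7) D'(6,7) a uv by auto
    ultimately show ?thesis by (auto simp: set_add_def')
  qed
  ultimately show ?thesis
    by (simp add: two_sided_ideal_def left_ideal_def right_ideal_def)
qed

lemma nil_ideal_sum:
  assumes "nil_ideal L R" "nil_ideal L' R"
  shows "nil_ideal (set_add R L L') R"
  unfolding nil_ideal_def
proof (intro conjI ballI)
  have L: "two_sided_ideal L R" and L': "two_sided_ideal L' R"
    using assms by (auto simp: nil_ideal_def)
  then show "two_sided_ideal (set_add R L L') R"
    by (rule two_sided_ideal_sum)
  fix x assume "x \<in> set_add R L L'"
  then obtain u v where uv: "u \<in> L" "v \<in> L'" "x = u \<oplus> v"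
    by (auto simp: set_add_def')
  have c: "u \<in> carrier R" "v \<in> carrier R"
    using uv two_sided_idealD(2)[OF L] two_sided_idealD(2)[OF L'] by auto
  from assms(1) uv obtain n where n: "n \<ge> 1" "pos_pow R u n = \<zero>"
    by (auto simp: nil_ideal_def)
  from pos_pow_mod_ideal[OF L' c(1) uv(2) n(1)] obtain z
    where z: "z \<in> L'" "pos_pow R x n = \<zero> \<oplus> z" using n uv by auto
  then have "pos_pow R x n \<in> L'" using two_sided_idealD(2)[OF L'] by auto
  with assms(2) obtain m where m: "m \<ge> 1" "pos_pow R (pos_pow R x n) m = \<zero>"
    by (auto simp: nil_ideal_def)
  with n c uv have "pos_pow R x (n * m) = \<zero>" by (simp add: pos_pow_mult)
  then show "\<exists>n\<ge>1. pos_pow R x n = \<zero>"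
    using n(1) m(1) by (intro exI[of _ "n * m"]) auto
qed

lemma nil_ideal_zero: "nil_ideal {\<zero>} R"
proof -
  have "additive_subgroup {\<zero>} R"
    by (intro additive_subgroupI subgroup.intro) (auto simp flip: a_inv_def)
  then show ?thesis
    by (auto simp: nil_ideal_def two_sided_ideal_def left_ideal_def right_ideal_def
        zero_mult mult_zero intro!: exI[of _ "Suc 0"] pos_pow_1)
qed

lemma nil_ideal_Union: "nil_ideal (\<Union>{L. nil_ideal L R}) R"
proof -
  let ?N = "\<Union>{L. nil_ideal L R}"
  have ts: "two_sided_ideal L R" if "nil_ideal L R" for L
    using that by (simp add: nil_ideal_def)
  note D = two_sided_idealD[OF ts]
  have add: "x \<oplus> y \<in> ?N" if "x \<in> ?N" "y \<in> ?N" for x y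
  proof -
    from that obtain L L' where "nil_ideal L R" "x \<in> L" "nil_ideal L' R" "y \<in> L'" by blast
    then show ?thesis
      using nil_ideal_sum[of L L'] by (auto simp: set_add_def')
  qed
  have "additive_subgroup ?N R"
  proof (intro additive_subgroupI subgroup.intro)
    show "?N \<subseteq> carrier (add_monoid R)" using D(2) by auto
    show "\<one>\<^bsub>add_monoid R\<^esub> \<in> ?N" using nil_ideal_zero by auto
    show "x \<otimes>\<^bsub>add_monoid R\<^esub> y \<in> ?N" if "x \<in> ?N" "y \<in> ?N" for x y
      using add that by simp
    show "inv\<^bsub>add_monoid R\<^esub> x \<in> ?N" if "x \<in> ?N" for x
      using D(5) that by (auto simp flip: a_inv_def)
  qed
  moreover have "\<exists>n\<ge>1. pos_pow R x n = \<zero>" if "x \<in> ?N" for x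
    using that by (auto simp: nil_ideal_def)
  ultimately show ?thesis
    using D(6,7) unfolding nil_ideal_def[of ?N] two_sided_ideal_def left_ideal_def right_ideal_def
    by blast
qed

lemma upper_nilradical_greatest:
  "nil_ideal (upper_nilradical R) R"
  "nil_ideal L R \<Longrightarrow> L \<subseteq> upper_nilradical R"
proof -
  have "upper_nilradical R = \<Union>{L. nil_ideal L R}"
    unfolding upper_nilradical_def
    by (rule Greatest_equality) (use nil_ideal_Union in auto)
  then show "nil_ideal (upper_nilradical R) R" "nil_ideal L R \<Longrightarrow> L \<subseteq> upper_nilradical R"
    using nil_ideal_Union by auto
qed

lemma quotient_mult:
  assumes I: "two_sided_ideal I R" and x: "x \<in> carrier R" and y: "y \<in> carrier R"
  shows "(I +> x) \<otimes>\<^bsub>R Quot I\<^esub> (I +> y) = I +> (x \<otimes> y)"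
proof -
  note D = two_sided_idealD[OF I]
  interpret abelian_subgroup I R
    by (intro abelian_subgroupI3 D abelian_group_axioms)
  have 1: "I +> (a \<otimes> b) = I +> (x \<otimes> y)" if "a \<in> I +> x" "b \<in> I +> y" for a b
  proof -
    from that obtain h k where hk: "h \<in> I" "k \<in> I" "a = h \<oplus> x" "b = k \<oplus> y"
      by (auto simp: a_r_coset_def')
    then have c: "h \<in> carrier R" "k \<in> carrier R" using D(2) by auto
    then have "a \<otimes> b = (h \<otimes> (k \<oplus> y) \<oplus> x \<otimes> k) \<oplus> x \<otimes> y"
      using hk x y by (simp add: distrib_l distrib_r mult_closed a_assoc a_lcomm)
    moreover have "h \<otimes> (k \<oplus> y) \<oplus> x \<otimes> k \<in> I"
      using hk c x y by (intro D(4,6,7)) auto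
    ultimately have "a \<otimes> b \<in> I +> (x \<otimes> y)"
      by (auto simp: a_r_coset_def')
    then show ?thesis
      using x y by (intro a_repr_independence'[symmetric]) (auto intro: mult_closed)
  qed
  have "x \<in> I +> x" "y \<in> I +> y" using a_rcos_self x y by auto
  then have "(\<Union>a \<in> I +> x. \<Union>b \<in> I +> y. I +> (a \<otimes> b)) = I +> (x \<otimes> y)"
    using 1 by blast
  then show ?thesis
    by (simp add: FactRing_def rcoset_mult_def)
qed

lemma nonunital_ring_quotient:
  assumes I: "two_sided_ideal I R"
  shows "nonunital_ring (R Quot I)"
proof -
  note D = two_sided_idealD[OF I]
  interpret abelian_subgroup I R
    by (intro abelian_subgroupI3 D abelian_group_axioms)
  have "add_monoid (R Quot I) = R A_Mod I"
    by (simp add: FactRing_def A_FactGroup_defs A_RCOSETS_def set_add_def)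
  then have "comm_group (add_monoid (R Quot I))"
    using a_factorgroup_is_comm_group by simp
  then have ag: "abelian_group (R Quot I)"
    by (simp add: abelian_group_def abelian_monoid_def abelian_group_axioms_def comm_group_def)
  have car: "carrier (R Quot I) = (\<lambda>x. I +> x) ` carrier R"
    by (auto simp: FactRing_def A_RCOSETS_def')
  have add: "(I +> x) \<oplus>\<^bsub>R Quot I\<^esub> (I +> y) = I +> (x \<oplus> y)"
    if "x \<in> carrier R" "y \<in> carrier R" for x y
    using that by (simp add: FactRing_def a_rcos_sum)
  show ?thesis
    by (intro nonunital_ring.intro nonunital_ring_axioms.intro ag)
       (auto simp: car add quotient_mult[OF I] mult_closed mult_assoc distrib_l distrib_r)
qed

end


section \<open>C*-algebras\<close>

text \<open>
  No identity is assumed. Submultiplicativity of the norm is part of \<^class>\<open>real_normed_algebra\<close>,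
  whose real scalar multiplication and norm the complex structure extends.
\<close>

class cstar_algebra = real_normed_algebra + banach +
  fixes scaleC :: "complex \<Rightarrow> 'a \<Rightarrow> 'a"
    and star :: "'a \<Rightarrow> 'a"
  assumes scaleC_add_right: "scaleC c (x + y) = scaleC c x + scaleC c y"
    and scaleC_add_left: "scaleC (c + d) x = scaleC c x + scaleC d x"
    and scaleC_scaleC: "scaleC c (scaleC d x) = scaleC (c * d) x"
    and scaleR_scaleC: "scaleR r x = scaleC (complex_of_real r) x"
    and mult_scaleC_left: "scaleC c x * y = scaleC c (x * y)"
    and mult_scaleC_right: "x * scaleC c y = scaleC c (x * y)"
    and norm_scaleC: "norm (scaleC c x) = cmod c * norm x"
    and star_star: "star (star x) = x"
    and star_add: "star (x + y) = star x + star y"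
    and star_scaleC: "star (scaleC c x) = scaleC (cnj c) (star x)"
    and star_mult: "star (x * y) = star y * star x"
    and cstar_identity: "norm (star x * x) = (norm x)\<^sup>2"

text \<open>The ring structure of a type as a record; its \<^const>\<open>one\<close> is left unspecified.\<close>

definition type_ring :: "'a::Rings.ring ring"
  where "type_ring = \<lparr>carrier = UNIV, mult = (*), one = undefined, zero = 0, add = (+)\<rparr>"

lemma nonunital_ring_type_ring: "nonunital_ring (type_ring :: 'a::Rings.ring ring)"
proof -
  have "\<exists>y. y + x = 0" for x :: 'a
    by (rule exI[of _ "- x"]) simp
  then have "abelian_group (type_ring :: 'a ring)"
    by (intro abelian_groupI) (auto simp: type_ring_def add_ac)
  then show ?thesis
    by (intro nonunital_ring.intro nonunital_ring_axioms.intro)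
       (auto simp: type_ring_def algebra_simps)
qed

end

theory Submission
  imports Defs "HOL-Complex_Analysis.Complex_Analysis"
begin

text \<open>
  A prime ideal \<open>P\<close> is semiprime: \<open>x A x \<subseteq> P\<close> implies \<open>x \<in> P\<close>. Let \<open>f \<ge> 0\<close> be a function of a self-adjoint
  element with \<open>f\<^sup>2 \<in> P\<close> and put \<open>e = f\<^bsup>3/2\<^esup>\<close>. If \<open>d\<close> is self-adjoint and \<open>q = (e d\<^sup>2 e)\<^bsup>1/2\<^esup>\<close>, then
  \<open>q f\<^bsup>-1\<^esup>\<close> exists as a norm limit \<open>c\<close>, so \<open>e d\<^sup>2 e = q q\<^sup>* = c f\<^sup>2 c\<^sup>*\<close> lies in \<open>P\<close>. The elements
  \<open>d\<^sup>2\<close> span, hence \<open>e A e \<subseteq> P\<close> and \<open>e \<in> P\<close>. Iterating, \<open>h\<^sup>n \<in> P\<close> for \<open>h = x\<^sup>* x\<close> gives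
  \<open>|h|\<^bsup>r\<^esup> \<in> P\<close> for all \<open>r > 0\<close>, and \<open>x\<close> is a multiple of \<open>|h|\<^bsup>1/3\<^esup>\<close>. If \<open>x\<close> lies in a one-sided ideal
  that is radical over \<open>I\<close>, then a power of \<open>x\<^sup>* x\<close> or of \<open>x x\<^sup>*\<close> is in \<open>I\<close>, so \<open>x\<close> is in every prime
  ideal above \<open>I\<close>. For the nilradicals, this is applied to the preimage in \<open>A\<close> of the upper nilradical.

  Only polynomials in a self-adjoint \<open>s\<close> with \<open>\<parallel>s\<parallel> < 1\<close> have to be bounded to obtain the functional
  calculus: \<open>s\<close> is the real part of the unitary \<open>u = s + i (1 - s\<^sup>2)\<^bsup>1/2\<^esup>\<close>, and a polynomial in \<open>s\<close> is
  a trigonometric polynomial in \<open>u\<close>.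
\<close>

section \<open>Elementary facts on C*-algebras\<close>

lemma scaleC_0_left [simp]: "scaleC 0 (x::'a::cstar_algebra) = 0"
  using scaleC_add_left[of 0 0 x] by simp

lemma scaleC_0_right [simp]: "scaleC c (0::'a::cstar_algebra) = 0"
  using scaleC_add_right[of c "0::'a" 0] by simp

lemma scaleC_1 [simp]: "scaleC 1 (x::'a::cstar_algebra) = x"
  using scaleR_scaleC[of 1 x] by simp

lemma scaleC_minus_left: "scaleC (- c) (x::'a::cstar_algebra) = - scaleC c x"
  using scaleC_add_left[of c "- c" x] by (simp add: eq_neg_iff_add_eq_0 add.commute)

lemma scaleC_minus_right: "scaleC c (- x::'a::cstar_algebra) = - scaleC c x"
  using scaleC_add_right[of c x "- x"] by (simp add: eq_neg_iff_add_eq_0 add.commute)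

lemma scaleC_diff_right: "scaleC c (x - y::'a::cstar_algebra) = scaleC c x - scaleC c y"
  using scaleC_add_right[of c x "- y"] by (simp add: scaleC_minus_right)

lemma scaleC_scaleR: "scaleC c (scaleR r (x::'a::cstar_algebra)) = scaleR r (scaleC c x)"
  by (simp add: scaleR_scaleC scaleC_scaleC mult.commute)

lemma bounded_linear_scaleC: "bounded_linear (scaleC c :: 'a::cstar_algebra \<Rightarrow> 'a)"
  by (rule bounded_linear_intro[where K = "cmod c"])
     (simp_all add: scaleC_add_right scaleC_scaleR norm_scaleC mult.commute)

lemma star_0 [simp]: "star (0::'a::cstar_algebra) = 0"
  using star_add[of "0::'a" 0] by simp

lemma star_minus: "star (- x::'a::cstar_algebra) = - star x"
  using star_add[of x "- x"] by (simp add: eq_neg_iff_add_eq_0 add.commute)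

lemma star_diff: "star (x - y::'a::cstar_algebra) = star x - star y"
  using star_add[of x "- y"] by (simp add: star_minus)

lemma star_scaleR: "star (scaleR r (x::'a::cstar_algebra)) = scaleR r (star x)"
  by (simp add: scaleR_scaleC star_scaleC)

text \<open>The C*-identity and submultiplicativity bound \<open>norm y\<close> by
  \<open>norm (star y)\<close>; applying this to \<open>star x\<close> as well gives
  equality.\<close>

lemma norm_star [simp]: "norm (star (x::'a::cstar_algebra)) = norm x"
proof -
  have le: "norm y \<le> norm (star y)" for y :: 'a
  proof (cases "y = 0")
    case False
    have "norm y * norm y \<le> norm (star y) * norm y"
      using norm_mult_ineq[of "star y" y] by (simp add: cstar_identity power2_eq_square)
    then show ?thesis using False by simp
  qed simp
  from le[of x] le[of "star x"] show ?thesis by (simp add: star_star)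
qed

lemma bounded_linear_star: "bounded_linear (star :: 'a::cstar_algebra \<Rightarrow> 'a)"
  by (rule bounded_linear_intro[where K = 1]) (simp_all add: star_add star_scaleR)

lemma norm_mult_star: "norm (x * star x) = (norm (x::'a::cstar_algebra))\<^sup>2"
  using cstar_identity[of "star x"] by (simp add: star_star)


section \<open>The unitization\<close>

datatype 'a unitization = Unitization (base: 'a) (scal: complex)

instantiation unitization :: (cstar_algebra) real_vector
begin
definition "0 = Unitization 0 0"
definition "X + Y = Unitization (base X + base Y) (scal X + scal Y)"
definition "- X = Unitization (- base X) (- scal X)"
definition "X - Y = Unitization (base X - base Y) (scal X - scal Y)"
definition "scaleR r X = Unitization (scaleR r (base X)) (scaleR r (scal X))"

lemma unitization_linear_sel [simp]:
  "base (0::'a unitization) = 0" "scal (0::'a unitization) = 0"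
  "base (X + Y::'a unitization) = base X + base Y" "scal (X + Y) = scal X + scal Y"
  "base (- X) = - base X" "scal (- X) = - scal X"
  "base (X - Y) = base X - base Y" "scal (X - Y) = scal X - scal Y"
  "base (scaleR r X) = scaleR r (base X)" "scal (scaleR r X) = scaleR r (scal X)"
  by (simp_all add: zero_unitization_def plus_unitization_def uminus_unitization_def
      minus_unitization_def scaleR_unitization_def)

instance
  by standard (auto intro!: unitization.expand simp: algebra_simps)
end

instantiation unitization :: (cstar_algebra) real_algebra_1
begin
definition "1 = Unitization 0 1"
definition "X * Y = Unitization
  (base X * base Y + scaleC (scal X) (base Y) + scaleC (scal Y) (base X)) (scal X * scal Y)"

lemma unitization_mult_sel [simp]:
  "base (1::'a unitization) = 0" "scal (1::'a unitization) = 1"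
  "base (X * Y::'a unitization) =
    base X * base Y + scaleC (scal X) (base Y) + scaleC (scal Y) (base X)"
  "scal (X * Y) = scal X * scal Y"
  by (simp_all add: one_unitization_def times_unitization_def)

instance
proof
  show "(0::'a unitization) \<noteq> 1"
    by (simp add: zero_unitization_def one_unitization_def)
qed (auto intro!: unitization.expand simp: algebra_simps scaleC_add_left scaleC_add_right
      scaleC_scaleC mult_scaleC_left mult_scaleC_right scaleC_scaleR scaleR_scaleC
      scaleR_conv_of_real[where 'a = complex])
end

text \<open>Left multiplication by \<open>X\<close> on the original algebra, an ideal of its
  unitization. It yields the norm here and later the extension of a prime ideal to the
  unitization.\<close>

definition umult :: "'a::cstar_algebra unitization \<Rightarrow> 'a \<Rightarrow> 'a"
  where "umult X y = base X * y + scaleC (scal X) y"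

lemma bounded_linear_umult: "bounded_linear (umult X)"
  unfolding umult_def
  by (intro bounded_linear_add bounded_linear_mult_right bounded_linear_scaleC)

lemma umult_mult: "umult (X * Y) y = umult X (umult Y y)"
  by (simp add: umult_def algebra_simps mult_scaleC_left mult_scaleC_right scaleC_scaleC
      scaleC_add_right)

instantiation unitization :: (cstar_algebra) real_normed_algebra_1
begin
text \<open>The maximum makes this a norm also if the algebra is already unital, when the operator norm
  alone vanishes on the difference of the two identities.\<close>
definition "norm X = max (cmod (scal X)) (onorm (umult X))"
definition "sgn (X::'a unitization) = X /\<^sub>R norm X"
definition "dist (X::'a unitization) Y = norm (X - Y)"
definition [code del]:
  "(uniformity :: ('a unitization \<times> 'a unitization) filter) =
    (INF e\<in>{0<..}. principal {(X, Y). dist X Y < e})"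
definition [code del]: "open (S :: 'a unitization set) \<longleftrightarrow>
  (\<forall>X\<in>S. \<forall>\<^sub>F (X', Y) in uniformity. X' = X \<longrightarrow> Y \<in> S)"

instance
proof
  fix X Y :: "'a unitization" and r :: real
  show "norm X = 0 \<longleftrightarrow> X = 0"
  proof
    assume "norm X = 0"
    then have "scal X = 0" "onorm (umult X) = 0"
      using onorm_pos_le[OF bounded_linear_umult[of X]]
      by (auto simp: norm_unitization_def max_def split: if_splits)
    then have "base X * y = 0" for y
      using onorm_eq_0[OF bounded_linear_umult[of X]] by (auto simp: umult_def)
    then have "norm (base X) = 0"
      using norm_mult_star[of "base X"] by simp
    then show "X = 0"
      using \<open>scal X = 0\<close> by (auto intro!: unitization.expand)
  next
    have "umult (0::'a unitization) = (\<lambda>y. 0)" by (auto simp: umult_def)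
    then show "norm X = 0" if "X = 0" using that by (simp add: norm_unitization_def onorm_zero)
  qed
  have *: "umult (X + Y) = (\<lambda>y. umult X y + umult Y y)"
    by (auto simp: umult_def scaleC_add_left algebra_simps)
  show "norm (X + Y) \<le> norm X + norm Y"
    using onorm_triangle[OF bounded_linear_umult[of X] bounded_linear_umult[of Y]]
      norm_triangle_ineq[of "scal X" "scal Y"]
    by (auto simp: norm_unitization_def *)
  have *: "umult (r *\<^sub>R X) = (\<lambda>y. r *\<^sub>R umult X y)"
    by (auto simp: umult_def scaleC_scaleC scaleR_scaleC scaleC_add_right mult_scaleC_left
        scaleR_conv_of_real[where 'a = complex])
  show "norm (r *\<^sub>R X) = \<bar>r\<bar> * norm X"
    using onorm_scaleR[OF bounded_linear_umult[of X], of r]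
    by (auto simp: norm_unitization_def * max_mult_distrib_left)
  have *: "umult (X * Y) = umult X \<circ> umult Y"
    by (auto simp: umult_mult)
  have "onorm (umult X \<circ> umult Y) \<le> onorm (umult X) * onorm (umult Y)"
    by (rule onorm_compose) (rule bounded_linear_umult)+
  also have "\<dots> \<le> norm X * norm Y"
    by (intro mult_mono) (auto simp: norm_unitization_def onorm_pos_le[OF bounded_linear_umult] le_max_iff_disj)
  finally have "onorm (umult (X * Y)) \<le> norm X * norm Y"
    by (simp add: *)
  moreover have "cmod (scal (X * Y)) \<le> norm X * norm Y"
    unfolding unitization_mult_sel norm_mult
    by (intro mult_mono) (auto simp: norm_unitization_def le_max_iff_disj)
  ultimately show "norm (X * Y) \<le> norm X * norm Y"
    by (simp add: norm_unitization_def[of "X * Y"])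
  have "umult (1::'a unitization) = (\<lambda>y. y)"
    by (auto simp: umult_def)
  then show "norm (1::'a unitization) = 1"
    using onorm_id_le[where 'a = 'a] by (simp add: norm_unitization_def)
qed (simp_all add: sgn_unitization_def dist_unitization_def uniformity_unitization_def
      open_unitization_def)
end

lemma norm_scal_le: "cmod (scal X) \<le> norm X"
  by (simp add: norm_unitization_def)

lemma norm_umult_le: "norm (umult X y) \<le> norm X * norm y"
proof -
  have "norm (umult X y) \<le> onorm (umult X) * norm y"
    by (rule onorm[OF bounded_linear_umult])
  also have "\<dots> \<le> norm X * norm y"
    by (intro mult_right_mono) (auto simp: norm_unitization_def)
  finally show ?thesis .
qed

text \<open>Tested on \<open>star (base X)\<close>, left multiplication by \<open>base X\<close>
  attains its norm by the C*-identity. Together with \<open>norm_unitization_le\<close>, this makes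
  the norm equivalent to the sum of the norms of the components, hence complete.\<close>

lemma norm_base_le: "norm (base X) \<le> norm X + cmod (scal X)"
proof (cases "base X = 0")
  case False
  let ?y = "star (base X)"
  have "norm (base X) * norm ?y = norm (umult X ?y - scaleC (scal X) ?y)"
    using norm_mult_star[of "base X"] by (simp add: umult_def power2_eq_square)
  also have "\<dots> \<le> norm X * norm ?y + cmod (scal X) * norm ?y"
    by (intro order.trans[OF norm_triangle_ineq4] add_mono norm_umult_le) (simp add: norm_scaleC)
  finally have "norm (base X) * norm ?y \<le> (norm X + cmod (scal X)) * norm ?y"
    by (simp add: algebra_simps)
  then show ?thesis using False by simp
qed simp

lemma norm_unitization_le: "norm X \<le> norm (base X) + cmod (scal X)"
proof -
  have "onorm (umult X) \<le> norm (base X) + cmod (scal X)"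
  proof (rule onorm_bound)
    fix y
    have "norm (umult X y) \<le> norm (base X * y) + norm (scaleC (scal X) y)"
      unfolding umult_def by (rule norm_triangle_ineq)
    also have "\<dots> \<le> norm (base X) * norm y + cmod (scal X) * norm y"
      by (intro add_mono norm_mult_ineq) (simp add: norm_scaleC)
    finally show "norm (umult X y) \<le> (norm (base X) + cmod (scal X)) * norm y"
      by (simp add: algebra_simps)
  qed simp
  then show ?thesis by (simp add: norm_unitization_def)
qed

instance unitization :: (cstar_algebra) banach
proof
  fix X :: "nat \<Rightarrow> 'a unitization"
  assume X: "Cauchy X"
  have scal: "Cauchy (\<lambda>n. scal (X n))"
  proof (rule CauchyI)
    fix e :: real assume "e > 0"
    then obtain M where M: "\<And>m n. m \<ge> M \<Longrightarrow> n \<ge> M \<Longrightarrow> norm (X m - X n) < e"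
      using CauchyD[OF X] by blast
    show "\<exists>M. \<forall>m\<ge>M. \<forall>n\<ge>M. norm (scal (X m) - scal (X n)) < e"
      by (metis M norm_scal_le unitization_linear_sel(8) le_less_trans)
  qed
  have base: "Cauchy (\<lambda>n. base (X n))"
  proof (rule CauchyI)
    fix e :: real assume "e > 0"
    then obtain M where M: "\<And>m n. m \<ge> M \<Longrightarrow> n \<ge> M \<Longrightarrow> norm (X m - X n) < e / 2"
      using CauchyD[OF X, of "e / 2"] by auto
    have "norm (base (X m) - base (X n)) < e" if "m \<ge> M" "n \<ge> M" for m n
      using M[OF that] norm_scal_le[of "X m - X n"] norm_base_le[of "X m - X n"] by simp
    then show "\<exists>M. \<forall>m\<ge>M. \<forall>n\<ge>M. norm (base (X m) - base (X n)) < e" by blast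
  qed
  from scal base obtain a b where ab: "(\<lambda>n. scal (X n)) \<longlonglongrightarrow> a" "(\<lambda>n. base (X n)) \<longlonglongrightarrow> b"
    by (auto simp: Cauchy_convergent_iff convergent_def)
  have "(\<lambda>n. norm (base (X n) - b) + cmod (scal (X n) - a)) \<longlonglongrightarrow> 0 + 0"
    using ab by (intro tendsto_add) (simp_all add: tendsto_norm_zero_iff LIM_zero)
  then have "(\<lambda>n. X n - Unitization b a) \<longlonglongrightarrow> 0"
    by (intro Lim_null_comparison[of "\<lambda>n. X n - Unitization b a"
          "\<lambda>n. norm (base (X n) - b) + cmod (scal (X n) - a)"])
       (use norm_unitization_le[of "X _ - Unitization b a"] in simp_all)
  then have "X \<longlonglongrightarrow> Unitization b a"
    by (simp add: LIM_zero_iff)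
  then show "convergent X" by (auto simp: convergent_def)
qed

section \<open>The C*-structure of the unitization\<close>

instantiation unitization :: (cstar_algebra) cstar_algebra
begin
definition "scaleC c X = Unitization (scaleC c (base X)) (c * scal X)"
definition "star X = Unitization (star (base X)) (cnj (scal X))"

lemma unitization_star_sel [simp]:
  "base (scaleC c X :: 'a unitization) = scaleC c (base X)" "scal (scaleC c X) = c * scal X"
  "base (star X :: 'a unitization) = star (base X)" "scal (star X) = cnj (scal X)"
  by (simp_all add: scaleC_unitization_def star_unitization_def)

instance
proof
  fix X Y :: "'a unitization" and c d :: complex and r :: real
  have le: "norm (scaleC c X) \<le> cmod c * norm X" for c and X :: "'a unitization"
  proof -
    have "onorm (umult (scaleC c X)) \<le> cmod c * norm X"
    proof (rule onorm_bound)
      fix y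
      have "umult (scaleC c X) y = scaleC c (umult X y)"
        by (simp add: umult_def scaleC_add_right scaleC_scaleC mult_scaleC_left)
      then show "norm (umult (scaleC c X) y) \<le> cmod c * norm X * norm y"
        by (simp add: norm_scaleC mult.assoc mult_left_mono norm_umult_le)
    qed simp
    then show ?thesis
      by (simp add: norm_unitization_def[of "scaleC c X"] norm_mult mult_left_mono norm_scal_le)
  qed
  show "norm (scaleC c X) = cmod c * norm X"
  proof (cases "c = 0")
    case False
    have "X = scaleC (inverse c) (scaleC c X)"
      using False by (intro unitization.expand) (simp add: scaleC_scaleC)
    then have "norm X \<le> cmod (inverse c) * norm (scaleC c X)"
      using le by metis
    then have "cmod c * norm X \<le> norm (scaleC c X)"
      using False by (simp add: norm_divide field_simps)
    with le show ?thesis by (intro antisym) auto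
  qed (use le[of 0 X] in simp)
  show "norm (star X * X) = (norm X)\<^sup>2"
  proof (rule antisym)
    \<comment> \<open>This is the adjoint relation for left multiplication. Taking norms turns the
      C*-identity for \<open>umult X y\<close> into a bound on \<open>onorm (umult X)\<close> by the
      square root of \<open>norm (star X * X)\<close>.\<close>
    have adj: "star (umult X y) * umult X y = star y * umult (star X * X) y" for X :: "'a unitization" and y
      by (simp add: umult_mult) (simp add: umult_def star_add star_mult star_scaleC algebra_simps
          mult_scaleC_left mult_scaleC_right scaleC_scaleC scaleC_add_right)
    have le: "(norm X)\<^sup>2 \<le> norm (star X * X)" for X :: "'a unitization"
    proof -
      have "onorm (umult X) \<le> sqrt (norm (star X * X))"
      proof (rule onorm_bound)
        fix y
        have "(norm (umult X y))\<^sup>2 = norm (star y * umult (star X * X) y)"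
          by (simp add: adj flip: cstar_identity)
        also have "\<dots> \<le> norm y * (norm (star X * X) * norm y)"
          by (rule order.trans[OF norm_mult_ineq])
             (simp only: norm_star, intro mult_left_mono norm_umult_le norm_ge_zero)
        also have "\<dots> = (sqrt (norm (star X * X)) * norm y)\<^sup>2"
          by (simp add: power_mult_distrib power2_eq_square)
        finally show "norm (umult X y) \<le> sqrt (norm (star X * X)) * norm y"
          by (rule power2_le_imp_le) simp
      qed simp
      moreover have "cmod (scal X) \<le> sqrt (norm (star X * X))"
        using norm_scal_le[of "star X * X"]
        by (intro real_le_rsqrt) (simp add: norm_mult power2_eq_square)
      ultimately have "norm X \<le> sqrt (norm (star X * X))"
        by (simp add: norm_unitization_def[of X])
      then have "(norm X)\<^sup>2 \<le> (sqrt (norm (star X * X)))\<^sup>2"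
        by (intro power_mono) auto
      then show ?thesis by simp
    qed
    show "(norm X)\<^sup>2 \<le> norm (star X * X)" by (rule le)
    have ss: "star (star X) = X" for X :: "'a unitization"
      by (intro unitization.expand) (simp add: star_star)
    have le1: "norm X \<le> norm (star X)" for X :: "'a unitization"
    proof (cases "X = 0")
      case False
      have "norm X * norm X \<le> norm (star X) * norm X"
        using le[of X] norm_mult_ineq[of "star X" X] by (simp add: power2_eq_square)
      then show ?thesis using False by simp
    qed simp
    have "norm (star X) = norm X"
      using le1[of X] le1[of "star X"] by (simp add: ss)
    then show "norm (star X * X) \<le> (norm X)\<^sup>2"
      using norm_mult_ineq[of "star X" X] by (simp add: power2_eq_square)
  qed
qed (auto intro!: unitization.expand simp: algebra_simps scaleC_add_left scaleC_add_right
      scaleC_scaleC mult_scaleC_left mult_scaleC_right scaleR_scaleC star_star star_add star_mult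
      star_scaleC scaleR_conv_of_real[where 'a = complex])
end


section \<open>Polynomials in a self-adjoint element\<close>

class unital_cstar_algebra = cstar_algebra + real_normed_algebra_1

instance unitization :: (cstar_algebra) unital_cstar_algebra ..

lemma star_1 [simp]: "star (1::'a::unital_cstar_algebra) = 1"
  using star_mult[of "star (1::'a)" 1] by (simp add: star_star)

lemma star_power: "star (x ^ n) = star (x::'a::unital_cstar_algebra) ^ n"
  by (induction n) (simp_all add: star_mult power_commutes)

section \<open>Horner evaluation of real and complex polynomials at an element of the
  algebra\<close>

definition real_eval :: "real poly \<Rightarrow> 'a::unital_cstar_algebra \<Rightarrow> 'a"
  where "real_eval p x = fold_coeffs (\<lambda>a y. scaleR a 1 + x * y) p 0"

definition complex_eval :: "complex poly \<Rightarrow> 'a::unital_cstar_algebra \<Rightarrow> 'a"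
  where "complex_eval p x = fold_coeffs (\<lambda>a y. scaleC a 1 + x * y) p 0"

lemma real_eval_0 [simp]: "real_eval 0 x = 0"
  by (simp add: real_eval_def)

lemma real_eval_pCons [simp]: "real_eval (pCons a p) x = scaleR a 1 + x * real_eval p x"
  by (cases "p = 0 \<and> a = 0") (auto simp: real_eval_def)

lemma real_eval_1 [simp]: "real_eval 1 x = 1"
  by (simp add: one_pCons)

lemma real_eval_add: "real_eval (p + q) x = real_eval p x + real_eval q x"
  by (induction p q rule: poly_induct2) (simp_all add: algebra_simps scaleR_add_left)

lemma real_eval_smult: "real_eval (smult c p) x = scaleR c (real_eval p x)"
  by (induction p) (simp_all add: algebra_simps scaleR_add_right)

lemma real_eval_diff: "real_eval (p - q) x = real_eval p x - real_eval q x"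
  using real_eval_add[of p "- q" x] real_eval_smult[of "-1" q x] by simp

lemma real_eval_commute: "x * real_eval p x = real_eval p x * x"
  by (induction p) (simp_all add: algebra_simps, metis mult.assoc)

lemma real_eval_mult: "real_eval (p * q) x = real_eval p x * real_eval q x"
  by (induction p) (simp_all add: real_eval_add real_eval_smult algebra_simps)

lemma real_eval_power: "real_eval (p ^ n) x = real_eval p x ^ n"
  by (induction n) (simp_all add: real_eval_mult)

lemma star_real_eval: "star x = x \<Longrightarrow> star (real_eval p x) = real_eval p x"
  by (induction p) (simp_all add: star_add star_mult star_scaleR real_eval_commute)

lemma complex_eval_0 [simp]: "complex_eval 0 x = 0"
  by (simp add: complex_eval_def)

lemma complex_eval_pCons [simp]:
  "complex_eval (pCons a p) x = scaleC a 1 + x * complex_eval p x"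
  by (cases "p = 0 \<and> a = 0") (auto simp: complex_eval_def)

lemma complex_eval_add: "complex_eval (p + q) x = complex_eval p x + complex_eval q x"
  by (induction p q rule: poly_induct2) (simp_all add: algebra_simps scaleC_add_left)

lemma complex_eval_smult: "complex_eval (smult c p) x = scaleC c (complex_eval p x)"
  by (induction p) (simp_all add: algebra_simps scaleC_add_right scaleC_scaleC mult_scaleC_right)

lemma complex_eval_monom: "complex_eval (monom c n) x = scaleC c (x ^ n)"
  by (induction n) (simp_all add: monom_0 monom_Suc mult_scaleC_right)

lemma complex_eval_sum: "complex_eval (sum f S) x = (\<Sum>i\<in>S. complex_eval (f i) x)"
  by (induction S rule: infinite_finite_induct) (simp_all add: complex_eval_add)

section \<open>Norm bounds for polynomials in a self-adjoint strict contraction\<close>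

lemma norm_complex_eval_le:
  assumes "norm x \<le> 1" and "\<And>i. cmod (coeff p i) \<le> M" and "degree p \<le> n"
  shows "norm (complex_eval p x) \<le> (real n + 1) * M"
proof -
  have "p = (\<Sum>i\<le>n. monom (coeff p i) i)"
    using assms(3) by (simp add: poly_as_sum_of_monoms')
  then have "complex_eval p x = (\<Sum>i\<le>n. scaleC (coeff p i) (x ^ i))"
    by (metis (no_types, lifting) complex_eval_monom complex_eval_sum sum.cong)
  also have "norm \<dots> \<le> (\<Sum>i\<le>n. M * 1)"
  proof (intro order.trans[OF norm_sum] sum_mono)
    fix i
    have "norm (x ^ i) \<le> 1"
      using norm_power_ineq[of x i] power_mono[OF assms(1), of i] by simp
    then show "norm (scaleC (coeff p i) (x ^ i)) \<le> M * 1"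
      unfolding norm_scaleC
      using order.trans[OF norm_ge_zero assms(2)] by (intro mult_mono assms(2)) auto
  qed
  finally show ?thesis by (simp add: algebra_simps)
qed

text \<open>Cauchy's estimate on the unit circle bounds the \<open>j\<close>-th derivative at 0,
  which is \<open>fact j\<close> times the coefficient.\<close>

lemma coeff_bound_unit_circle:
  fixes q :: "complex poly"
  assumes "\<And>z. cmod z = 1 \<Longrightarrow> cmod (poly q z) \<le> M"
  shows "cmod (coeff q j) \<le> M"
proof -
  have d: "(deriv ^^ j) (poly q) = poly ((pderiv ^^ j) q)"
    by (induction j) (auto intro!: ext DERIV_imp_deriv poly_DERIV)
  have "norm ((deriv ^^ j) (poly q) 0) \<le> fact j * M / 1 ^ j"
    using assms by (intro Cauchy_inequality) (auto intro!: holomorphic_intros continuous_intros)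
  moreover have "(deriv ^^ j) (poly q) 0 = fact j * coeff q j"
    by (simp add: d poly_0_coeff_0 coeff_higher_pderiv pochhammer_fact[symmetric])
  ultimately show ?thesis by (simp add: norm_mult)
qed

text \<open>With \<open>x = cos \<theta>\<close> and \<open>u = e\<^sup>i\<^sup>\<theta>\<close>, multiplying a polynomial in \<open>cos \<theta>\<close> by a power of \<open>u\<close> clears the
  negative powers.\<close>

lemma trigonometric_form:
  fixes u v s :: "'a::unital_cstar_algebra" and p :: "real poly"
  assumes uv: "u * v = 1" "v * u = 1" and s: "scaleR 2 s = u + v"
  shows "\<exists>q. degree q \<le> 2 * length (coeffs p) \<and>
    (\<forall>z. cmod z = 1 \<longrightarrow> poly q z = z ^ length (coeffs p) * of_real (poly p (Re z))) \<and>
    complex_eval q u = u ^ length (coeffs p) * real_eval p s"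
proof (induction p)
  case 0
  then show ?case by (intro exI[of _ 0]) auto
next
  case (pCons a p)
  let ?D = "length (coeffs p)"
  from pCons obtain q where q: "degree q \<le> 2 * ?D"
    "\<And>z. cmod z = 1 \<Longrightarrow> poly q z = z ^ ?D * of_real (poly p (Re z))"
    "complex_eval q u = u ^ ?D * real_eval p s" by blast
  have len: "length (coeffs (pCons a p)) = Suc ?D"
    using pCons by (auto simp: cCons_def)
  \<comment> \<open>On the circle \<open>z * Re z = (1 + z * z) / 2\<close>. Hence the new factor
    \<open>Re z\<close> of Horner's scheme, paired with the one extra power of \<open>z\<close>,
    becomes multiplication by a polynomial; \<open>u\<close> and \<open>s\<close> satisfy the same
    relation.\<close>
  let ?q = "monom (of_real a) (Suc ?D) + smult (1 / 2) (q + pCons 0 (pCons 0 q))"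
  have "degree (pCons 0 (pCons 0 q)) \<le> 2 * Suc ?D"
    using q(1) by (auto intro!: order.trans[OF degree_pCons_le])
  then have "degree ?q \<le> 2 * Suc ?D"
    using q(1) by (intro degree_add_le degree_monom_le[THEN order.trans]
        degree_smult_le[THEN order.trans]) auto
  moreover have "poly ?q z = z ^ Suc ?D * of_real (poly (pCons a p) (Re z))" if z: "cmod z = 1" for z
  proof -
    have "z * cnj z = 1" using z by (simp add: complex_norm_square[symmetric])
    moreover have "2 * of_real (Re z) = z + cnj z" by (simp add: complex_add_cnj)
    ultimately have zz: "1 + z * z = z * (2 * of_real (Re z))"
      by (simp add: algebra_simps)
    then have "poly ?q z = of_real a * z ^ Suc ?D + (z * (2 * of_real (Re z))) / 2 * poly q z"
      by (simp add: poly_monom algebra_simps flip: zz)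
    then show ?thesis by (simp add: q(2)[OF z] algebra_simps)
  qed
  moreover have "complex_eval ?q u = u ^ Suc ?D * real_eval (pCons a p) s"
  proof -
    have "s * u = u * s"
    proof -
      have "scaleR 2 s * u = u * scaleR 2 s"
        by (simp only: s) (simp add: uv distrib_left distrib_right)
      then show ?thesis by simp
    qed
    then have us: "u ^ n * s = s * u ^ n" for n
      by (metis power_commuting_commutes)
    have uu: "1 + u * u = scaleR 2 (u * s)"
    proof -
      have "u * scaleR 2 s = u * u + u * v" by (simp only: s distrib_left)
      then show ?thesis using uv by (simp add: add.commute)
    qed
    then have "scaleC (1 / 2) (complex_eval q u + u * (u * complex_eval q u)) =
        scaleC (1 / 2) (scaleR 2 (u * s) * complex_eval q u)"
      by (simp add: algebra_simps flip: uu)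
    also have "\<dots> = u * s * complex_eval q u"
      by (simp add: scaleR_scaleC scaleC_scaleC mult_scaleC_left)
    also have "\<dots> = u ^ Suc ?D * s * real_eval p s"
      by (simp add: q(3) us mult.assoc)
    finally show ?thesis
      by (simp add: complex_eval_add complex_eval_smult complex_eval_monom scaleR_scaleC
          algebra_simps mult_scaleC_right)
  qed
  ultimately show ?case unfolding len by blast
qed

text \<open>\<open>c\<close> is the binomial series of exponent 1/2 in \<open>t = - (s * s)\<close>,
  absolutely convergent as \<open>norm t < 1\<close>. Its Cauchy square is the series of exponent 1
  by Vandermonde's identity, and this stops after \<open>1 + t\<close>.\<close>

lemma sqrt_one_minus_square:
  fixes s :: "'a::unital_cstar_algebra"
  assumes s: "star s = s" "norm s < 1"
  obtains c where "star c = c" "c * c = 1 - s * s" "c * s = s * c"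
proof -
  define t where "t = - (s * s)"
  define a where "a k = ((1 / 2 :: real) gchoose k) *\<^sub>R t ^ k" for k
  have "norm t \<le> norm s * norm s" by (simp add: t_def norm_mult_ineq)
  also have "\<dots> < 1" using s(2) using mult_strict_mono[of "norm s" 1 "norm s" 1] by (cases "s = 0") auto
  finally have t: "norm t < 1" .
  have "conv_radius (\<lambda>k. (1 / 2 :: real) gchoose k) \<ge> 1"
    by (subst conv_radius_gchoose) auto
  then have "summable (\<lambda>k. norm (((1 / 2 :: real) gchoose k) * norm t ^ k))"
    using t by (intro abs_summable_in_conv_radius) (auto intro: less_le_trans simp flip: ereal_less(3))
  then have sn: "summable (\<lambda>k. norm (a k))"
    by (rule summable_comparison_test'[where N = 0])
       (auto simp: a_def abs_mult intro!: mult_left_mono norm_power_ineq)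
  then have sa: "summable a" by (rule summable_norm_cancel)
  define c where "c = suminf a"
  have "(\<lambda>k. \<Sum>i\<le>k. a i * a (k - i)) sums (c * c)"
    unfolding c_def by (rule Cauchy_product_sums[OF sn sn])
  moreover have "(\<Sum>i\<le>k. a i * a (k - i)) = ((1 :: real) gchoose k) *\<^sub>R t ^ k" for k
  proof -
    have "(\<Sum>i\<le>k. a i * a (k - i)) =
        (\<Sum>i\<le>k. (((1 / 2 :: real) gchoose i) * ((1 / 2) gchoose (k - i))) *\<^sub>R t ^ k)"
      by (intro sum.cong) (auto simp: a_def mult_ac simp flip: power_add)
    also have "\<dots> = (\<Sum>i\<le>k. ((1 / 2 :: real) gchoose i) * ((1 / 2) gchoose (k - i))) *\<^sub>R t ^ k"
      by (rule scaleR_left.sum[symmetric])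
    also have "(\<Sum>i\<le>k. ((1 / 2 :: real) gchoose i) * ((1 / 2) gchoose (k - i))) = 1 gchoose k"
      using gbinomial_Vandermonde[of "1 / 2 :: real" "1 / 2" k] by (simp add: atMost_atLeast0)
    finally show ?thesis .
  qed
  ultimately have "(\<lambda>k. ((1 :: real) gchoose k) *\<^sub>R t ^ k) sums (c * c)" by simp
  moreover have "(\<lambda>k. ((1 :: real) gchoose k) *\<^sub>R t ^ k) sums
      (\<Sum>k\<in>{0, 1}. ((1 :: real) gchoose k) *\<^sub>R t ^ k)"
  proof (rule sums_finite)
    fix k :: nat assume "k \<notin> {0, 1}"
    then have "(1 :: real) gchoose k = 0"
      using gbinomial_Suc_Suc[of "0::real" "k - 1"] by (cases k; cases "k - 1") auto
    then show "((1 :: real) gchoose k) *\<^sub>R t ^ k = 0" by simp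
  qed simp
  ultimately have "c * c = 1 + t" using sums_unique2 by fastforce
  moreover have "star c = c"
  proof -
    have "star t = t" by (simp add: t_def star_minus star_mult s)
    then have "star (a k) = a k" for k by (simp add: a_def star_scaleR star_power)
    then show ?thesis
      using bounded_linear.suminf[OF bounded_linear_star sa] by (simp add: c_def)
  qed
  moreover have "c * s = s * c"
  proof -
    have "t * s = s * t" by (simp add: t_def mult.assoc)
    then have "a k * s = s * a k" for k by (simp add: a_def power_commuting_commutes)
    then show ?thesis
      using bounded_linear.suminf[OF bounded_linear_mult_left sa, of s]
        bounded_linear.suminf[OF bounded_linear_mult_right sa, of s] by (simp add: c_def)
  qed
  ultimately show ?thesis using that by (simp add: t_def)
qed

text \<open>Multiplication by a power of the unitary \<open>u\<close> turns
  \<open>real_eval p s\<close> into an ordinary polynomial in \<open>u\<close>. Its coefficients are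
  at most \<open>M\<close> by Cauchy's estimate, so the triangle inequality costs only the number of
  terms.\<close>

lemma norm_real_eval_weak:
  fixes s :: "'a::unital_cstar_algebra"
  assumes s: "star s = s" "norm s < 1"
    and M: "\<And>x. x \<in> {-1..1} \<Longrightarrow> \<bar>poly p x\<bar> \<le> M"
  shows "norm (real_eval p s) \<le> (2 * real (degree p) + 3) * M"
proof -
  obtain c where c: "star c = c" "c * c = 1 - s * s" "c * s = s * c"
    using sqrt_one_minus_square[OF s] .
  define u where "u = s + scaleC \<i> c"
  define v where "v = s - scaleC \<i> c"
  have "u * v = s * s + c * c" "v * u = s * s + c * c"
    by (simp_all add: u_def v_def algebra_simps mult_scaleC_left mult_scaleC_right scaleC_scaleC
        c(3) scaleC_minus_left scaleC_diff_right scaleC_add_right)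
  then have uv: "u * v = 1" "v * u = 1" by (simp_all add: c(2))
  have sv: "star u = v" "star v = u"
    by (simp_all add: u_def v_def star_add star_diff star_scaleC s c scaleC_minus_left)
  have n: "norm u \<le> 1" "norm v \<le> 1"
    using cstar_identity[of u] cstar_identity[of v] uv sv
    by (auto simp: power2_eq_1_iff intro: order.trans[OF _ norm_ge_zero])
  have "scaleR 2 s = u + v"
    by (simp add: u_def v_def scaleR_2)
  from trigonometric_form[OF uv this, of p] obtain q where q: "degree q \<le> 2 * length (coeffs p)"
    "\<And>z. cmod z = 1 \<Longrightarrow> poly q z = z ^ length (coeffs p) * of_real (poly p (Re z))"
    "complex_eval q u = u ^ length (coeffs p) * real_eval p s" by blast
  have M0: "M \<ge> 0" using M[of 0] by auto
  have "cmod (poly q z) \<le> M" if "cmod z = 1" for z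
    using M[of "Re z"] abs_Re_le_cmod[of z] that
    by (auto simp: q(2) norm_mult norm_power abs_le_iff)
  then have "cmod (coeff q j) \<le> M" for j by (rule coeff_bound_unit_circle)
  then have "norm (complex_eval q u) \<le> (real (2 * length (coeffs p)) + 1) * M"
    using n q(1) by (intro norm_complex_eval_le)
  also have "\<dots> \<le> (2 * real (degree p) + 3) * M"
    using M0 by (cases "p = 0") (auto simp: length_coeffs_degree intro!: mult_right_mono)
  finally have *: "norm (complex_eval q u) \<le> (2 * real (degree p) + 3) * M" .
  \<comment> \<open>The power of \<open>u\<close> is undone by the same power of its inverse
    \<open>v\<close>, which is also a contraction.\<close>
  have "v ^ k * u ^ k = 1" for k
  proof (induction k)
    case (Suc k)
    have "v ^ Suc k * u ^ Suc k = v ^ k * (v * u) * u ^ k"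
      by (simp add: mult.assoc power_commutes) (simp add: power_commutes flip: mult.assoc)
    then show ?case using Suc uv by simp
  qed simp
  then have "real_eval p s = v ^ length (coeffs p) * complex_eval q u"
    by (simp add: q(3) flip: mult.assoc)
  also have "norm \<dots> \<le> 1 * norm (complex_eval q u)"
    using norm_power_ineq[of v] power_mono[OF n(2), of "length (coeffs p)"]
    by (intro order.trans[OF norm_mult_ineq] mult_right_mono) (auto intro: order.trans)
  finally show ?thesis using * by simp
qed

lemma norm_power_2_power:
  fixes x :: "'a::unital_cstar_algebra"
  assumes "star x = x"
  shows "norm (x ^ 2 ^ k) = norm x ^ 2 ^ k"
proof (induction k)
  case (Suc k)
  have "star (x ^ 2 ^ k) = x ^ 2 ^ k" by (simp add: star_power assms)
  then have "norm (x ^ 2 ^ k * x ^ 2 ^ k) = (norm (x ^ 2 ^ k))\<^sup>2"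
    using cstar_identity[of "x ^ 2 ^ k"] by simp
  then show ?case by (simp add: Suc power_mult mult.commute[of 2] flip: power2_eq_square)
qed simp

text \<open>The factor that grows linearly in the degree disappears when the bound is applied to powers.\<close>

lemma norm_real_eval_le:
  fixes s :: "'a::unital_cstar_algebra"
  assumes s: "star s = s" "norm s < 1"
    and M: "\<And>x. x \<in> {-1..1} \<Longrightarrow> \<bar>poly p x\<bar> \<le> M"
  shows "norm (real_eval p s) \<le> M"
proof (rule ccontr)
  define y where "y = norm (real_eval p s)"
  \<comment> \<open>If the claim failed, this ratio would be below 1, and its powers would beat the
    linear factor of the weak bound for \<open>p ^ n\<close>.\<close>
  define x where "x = M / y"
  define d where "d = degree p"
  assume "\<not> norm (real_eval p s) \<le> M"
  then have y: "M < y" by (simp add: y_def)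
  have M0: "M \<ge> 0" using M[of 0] by auto
  have x: "norm x < 1" "x \<ge> 0" using y M0 by (auto simp: x_def)
  have "(\<lambda>n. 2 * real d * (real n * x ^ n) + 3 * x ^ n) \<longlonglongrightarrow> 2 * real d * 0 + 3 * 0"
    using x by (intro tendsto_intros powser_times_n_limit_0 LIMSEQ_power_zero)
  then have "(\<lambda>n. (2 * real d * real n + 3) * x ^ n) \<longlonglongrightarrow> 0"
    by (simp add: algebra_simps)
  then have "\<forall>\<^sub>F n in sequentially. (2 * real d * real n + 3) * x ^ n < 1"
    by (rule order_tendstoD) simp
  then obtain k where k: "\<And>n. n \<ge> k \<Longrightarrow> (2 * real d * real n + 3) * x ^ n < 1"
    by (auto simp: eventually_sequentially)
  \<comment> \<open>For an exponent that is a power of two, \<open>norm_power_2_power\<close> lets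
    the norm of a self-adjoint power be computed exactly; moreover \<open>2 ^ k\<close> is at least
    \<open>k\<close>.\<close>
  define N :: nat where "N = 2 ^ k"
  have "N \<ge> k" by (simp add: N_def less_exp less_imp_le)
  have "y ^ N = norm (real_eval (p ^ N) s)"
    unfolding y_def N_def real_eval_power
    by (rule norm_power_2_power[symmetric]) (rule star_real_eval[OF s(1)])
  also have "\<dots> \<le> (2 * real (degree (p ^ N)) + 3) * M ^ N"
    by (rule norm_real_eval_weak[OF s]) (auto simp: power_abs intro!: power_mono M)
  also have "\<dots> \<le> (2 * (real d * real N) + 3) * M ^ N"
    using M0 degree_power_le[of p N]
    by (intro mult_right_mono add_right_mono mult_left_mono)
       (auto simp: d_def simp flip: of_nat_mult)
  finally have "1 \<le> (2 * real d * real N + 3) * M ^ N / y ^ N"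
    using y M0 by (simp add: le_divide_eq mult.assoc)
  also have "\<dots> = (2 * real d * real N + 3) * x ^ N"
    by (simp add: x_def power_divide)
  finally show False using k[OF \<open>N \<ge> k\<close>] by simp
qed


section \<open>Continuous functional calculus\<close>

lemma polynomial_approximation:
  fixes f :: "real \<Rightarrow> real"
  assumes "continuous_on {-1..1} f" "e > 0"
  obtains p where "\<And>x. x \<in> {-1..1} \<Longrightarrow> \<bar>f x - poly p x\<bar> \<le> e"
proof -
  obtain g where g: "real_polynomial_function g" "\<And>x. x \<in> {-1..1} \<Longrightarrow> \<bar>f x - g x\<bar> < e"
    using Stone_Weierstrass_real_polynomial_function[of "{-1..1}" f e] assms by auto
  from g(1) obtain a n where "g = (\<lambda>x. \<Sum>i\<le>n. a i * x ^ i)"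
    by (auto simp: real_polynomial_function_iff_sum)
  then have "g x = poly (\<Sum>i\<le>n. monom (a i) i) x" for x
    by (simp add: poly_sum poly_monom)
  with g(2) that show ?thesis by (metis less_imp_le)
qed

text \<open>The restriction to \<open>e <= 1\<close> lets \<open>cfc_mult\<close> bound the
  approximating polynomials independently of \<open>e\<close>.\<close>

lemma eq_if_norm_diff_le:
  fixes a b :: "'a::real_normed_vector"
  assumes "\<And>e. 0 < e \<Longrightarrow> e \<le> 1 \<Longrightarrow> norm (a - b) \<le> C * e"
  shows "a = b"
proof (rule ccontr)
  assume "a \<noteq> b"
  then have n: "norm (a - b) > 0" by simp
  define e where "e = min 1 (norm (a - b) / (2 * (\<bar>C\<bar> + 1)))"
  have e: "0 < e" "e \<le> 1" using n by (auto simp: e_def)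
  have "norm (a - b) \<le> C * e" using assms e by blast
  also have "\<dots> \<le> (\<bar>C\<bar> + 1) * e" using e by (intro mult_right_mono) auto
  also have "\<dots> \<le> (\<bar>C\<bar> + 1) * (norm (a - b) / (2 * (\<bar>C\<bar> + 1)))"
    by (intro mult_left_mono) (auto simp: e_def)
  also have "\<dots> = norm (a - b) / 2" by (simp add: field_simps)
  finally show False using n by simp
qed

lemma norm_eq_0_if_le_divide:
  fixes x :: "'a::real_normed_vector"
  assumes "\<And>k::nat. k \<ge> 1 \<Longrightarrow> norm x \<le> C / real k"
  shows "x = 0"
proof -
  have "(\<lambda>k. C / real k) \<longlonglongrightarrow> 0" by (rule lim_const_over_n)
  then have "norm x \<le> 0"
    by (rule tendsto_le[OF sequentially_bot _ tendsto_const])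
       (use assms in \<open>auto simp: eventually_sequentially\<close>)
  then show ?thesis by simp
qed

text \<open>The value is pinned down by all polynomial approximations at once: an error
  \<open>e\<close> on the interval must give an error of at most \<open>e\<close> in the algebra.
  The interval stands in for the spectrum, so norms are only bounded by suprema over it. The choice
  is known to be meaningful for continuous \<open>f\<close> and self-adjoint \<open>s\<close> with
  \<open>norm s < 1\<close>.\<close>

definition cfc :: "'a::unital_cstar_algebra \<Rightarrow> (real \<Rightarrow> real) \<Rightarrow> 'a"
  where "cfc s f = (SOME b. \<forall>p e. (\<forall>x\<in>{-1..1}. \<bar>f x - poly p x\<bar> \<le> e) \<longrightarrow>
    norm (b - real_eval p s) \<le> e)"

lemma cfc_cong: "(\<And>x. x \<in> {-1..1} \<Longrightarrow> f x = g x) \<Longrightarrow> cfc s f = cfc s g"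
proof -
  assume eq: "\<And>x. x \<in> {-1..1} \<Longrightarrow> f x = g x"
  have "(\<forall>x\<in>{-1..1}. \<bar>f x - poly p x\<bar> \<le> e) = (\<forall>x\<in>{-1..1}. \<bar>g x - poly p x\<bar> \<le> e)" for p e
    by (intro ball_cong refl) (simp only: eq)
  then show "cfc s f = cfc s g" by (simp only: cfc_def)
qed

locale selfadjoint_contraction =
  fixes s :: "'a::unital_cstar_algebra"
  assumes selfadjoint: "star s = s" and contraction: "norm s < 1"
begin

lemma norm_real_eval_diff_le:
  assumes "\<And>x. x \<in> {-1..1} \<Longrightarrow> \<bar>poly p x - poly q x\<bar> \<le> M"
  shows "norm (real_eval p s - real_eval q s) \<le> M"
  using norm_real_eval_le[OF selfadjoint contraction, of "p - q" M] assms
  by (simp add: real_eval_diff)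

text \<open>Shows that the choice in \<open>cfc\<close> has a witness: polynomials approximating
  \<open>f\<close> uniformly have Cauchy values at \<open>s\<close> by
  \<open>norm_real_eval_le\<close>, and their limit satisfies every required estimate.\<close>

lemma norm_cfc_diff_real_eval:
  assumes f: "continuous_on {-1..1} f"
    and p: "\<And>x. x \<in> {-1..1} \<Longrightarrow> \<bar>f x - poly p x\<bar> \<le> e"
  shows "norm (cfc s f - real_eval p s) \<le> e"
proof -
  have "\<forall>n. \<exists>q. \<forall>x\<in>{-1..1}. \<bar>f x - poly q x\<bar> \<le> 1 / real (Suc n)"
    using polynomial_approximation[OF f] by (metis of_nat_0_less_iff zero_less_Suc zero_less_divide_1_iff)
  then obtain q where q: "\<And>n x. x \<in> {-1..1} \<Longrightarrow> \<bar>f x - poly (q n) x\<bar> \<le> 1 / real (Suc n)"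
    by metis
  have lim: "(\<lambda>n. 1 / real (Suc n)) \<longlonglongrightarrow> 0"
    using LIMSEQ_Suc[OF lim_const_over_n[of 1]] by simp
  have le: "norm (real_eval (q m) s - real_eval r s) \<le> 1 / real (Suc m) + e"
    if "\<And>x. x \<in> {-1..1} \<Longrightarrow> \<bar>f x - poly r x\<bar> \<le> e" for m r e
    by (rule norm_real_eval_diff_le) (use q[of _ m] that in fastforce)
  have "Cauchy (\<lambda>n. real_eval (q n) s)"
  proof (rule CauchyI)
    fix e :: real assume "e > 0"
    then obtain M where M: "\<And>n. n \<ge> M \<Longrightarrow> 1 / real (Suc n) < e / 2"
      using order_tendstoD(2)[OF lim, of "e / 2"] by (auto simp: eventually_sequentially)
    have "norm (real_eval (q m) s - real_eval (q n) s) < e" if "m \<ge> M" "n \<ge> M" for m n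
      using le[OF q, of m n] M[OF that(1)] M[OF that(2)] by linarith
    then show "\<exists>M. \<forall>m\<ge>M. \<forall>n\<ge>M. norm (real_eval (q m) s - real_eval (q n) s) < e" by blast
  qed
  then obtain b where b: "(\<lambda>n. real_eval (q n) s) \<longlonglongrightarrow> b"
    by (auto simp: Cauchy_convergent_iff convergent_def)
  have "norm (b - real_eval r s) \<le> e"
    if r: "\<And>x. x \<in> {-1..1} \<Longrightarrow> \<bar>f x - poly r x\<bar> \<le> e" for r e
  proof -
    have "(\<lambda>n. norm (real_eval (q n) s - real_eval r s)) \<longlonglongrightarrow> norm (b - real_eval r s)"
      by (intro tendsto_intros b)
    moreover have "(\<lambda>n. 1 / real (Suc n) + e) \<longlonglongrightarrow> 0 + e"
      by (intro tendsto_intros lim)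
    ultimately show ?thesis
      using tendsto_le[OF sequentially_bot] le[OF r] by (metis (no_types, lifting) add_0 always_eventually)
  qed
  then have "\<exists>b. \<forall>p e. (\<forall>x\<in>{-1..1}. \<bar>f x - poly p x\<bar> \<le> e) \<longrightarrow> norm (b - real_eval p s) \<le> e"
    by blast
  from someI_ex[OF this] p show ?thesis unfolding cfc_def by blast
qed

lemma cfc_poly: "cfc s (poly p) = real_eval p s"
  using norm_cfc_diff_real_eval[of "poly p" p 0] by (simp add: continuous_intros)

lemma cfc_const: "cfc s (\<lambda>x. c) = scaleR c 1"
proof -
  have "poly [:c:] = (\<lambda>x. c)" by auto
  then show ?thesis using cfc_poly[of "[:c:]"] by simp
qed

lemma cfc_ident: "cfc s (\<lambda>x. x) = s"
proof -
  have "poly [:0, 1:] = (\<lambda>x. x :: real)" by auto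
  then show ?thesis using cfc_poly[of "[:0, 1:]"] by simp
qed

lemma norm_cfc_le:
  assumes "continuous_on {-1..1} f" "\<And>x. x \<in> {-1..1} \<Longrightarrow> \<bar>f x\<bar> \<le> M"
  shows "norm (cfc s f) \<le> M"
  using norm_cfc_diff_real_eval[of f 0 M] assms by simp

lemma star_cfc:
  assumes f: "continuous_on {-1..1} f"
  shows "star (cfc s f) = cfc s f"
proof (rule eq_if_norm_diff_le)
  fix e :: real assume "0 < e"
  from polynomial_approximation[OF f this] obtain p
    where "\<And>x. x \<in> {-1..1} \<Longrightarrow> \<bar>f x - poly p x\<bar> \<le> e" by blast
  then have n: "norm (cfc s f - real_eval p s) \<le> e"
    by (rule norm_cfc_diff_real_eval[OF f])
  let ?d = "cfc s f - real_eval p s"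
  have eq: "star (cfc s f) - cfc s f = star ?d - ?d"
    by (simp add: star_diff star_real_eval selfadjoint)
  moreover have "norm (star ?d - ?d) \<le> norm (star ?d) + norm ?d"
    by (rule norm_triangle_ineq4)
  moreover have "norm (star ?d) \<le> e" using n by (simp only: norm_star)
  ultimately show "norm (star (cfc s f) - cfc s f) \<le> 2 * e"
    unfolding eq using n by linarith
qed

lemma cfc_diff:
  assumes f: "continuous_on {-1..1} f" and g: "continuous_on {-1..1} g"
  shows "cfc s (\<lambda>x. f x - g x) = cfc s f - cfc s g"
proof (rule eq_if_norm_diff_le)
  fix e :: real assume e: "0 < e"
  from polynomial_approximation[OF f e] obtain p
    where p: "\<And>x. x \<in> {-1..1} \<Longrightarrow> \<bar>f x - poly p x\<bar> \<le> e" by blast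
  from polynomial_approximation[OF g e] obtain q
    where q: "\<And>x. x \<in> {-1..1} \<Longrightarrow> \<bar>g x - poly q x\<bar> \<le> e" by blast
  have "norm (cfc s (\<lambda>x. f x - g x) - real_eval (p - q) s) \<le> 2 * e"
    using p q by (intro norm_cfc_diff_real_eval continuous_intros f g) fastforce
  moreover have "norm (cfc s f - real_eval p s) \<le> e" "norm (cfc s g - real_eval q s) \<le> e"
    using p q by (auto intro: norm_cfc_diff_real_eval f g)
  moreover have eq: "cfc s (\<lambda>x. f x - g x) - (cfc s f - cfc s g) =
      (cfc s (\<lambda>x. f x - g x) - real_eval (p - q) s) -
      ((cfc s f - real_eval p s) - (cfc s g - real_eval q s))" (is "_ = ?a - (?b - ?c)")
    by (simp add: real_eval_diff)
  moreover have "norm (?a - (?b - ?c)) \<le> norm ?a + (norm ?b + norm ?c)"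
    by (intro order.trans[OF norm_triangle_ineq4[of ?a]] add_left_mono norm_triangle_ineq4)
  ultimately show "norm (cfc s (\<lambda>x. f x - g x) - (cfc s f - cfc s g)) \<le> 4 * e"
    unfolding eq by linarith
qed

lemma cfc_add:
  assumes f: "continuous_on {-1..1} f" and g: "continuous_on {-1..1} g"
  shows "cfc s (\<lambda>x. f x + g x) = cfc s f + cfc s g"
  using cfc_diff[OF f, of "\<lambda>x. 0 - g x"] cfc_diff[OF _ g, of "\<lambda>x. 0"]
  by (simp add: cfc_const g continuous_on_minus)

lemma cfc_mult:
  assumes f: "continuous_on {-1..1} f" and g: "continuous_on {-1..1} g"
  shows "cfc s (\<lambda>x. f x * g x) = cfc s f * cfc s g"
proof -
  have bounded: "\<exists>B. \<forall>x\<in>{-1..1}. \<bar>h x\<bar> \<le> B" if "continuous_on {-1..1} h" for h :: "real \<Rightarrow> real"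
    using compact_imp_bounded[OF compact_continuous_image[OF that]] by (auto simp: bounded_iff)
  obtain Bf Bg where B: "\<And>x. x \<in> {-1..1} \<Longrightarrow> \<bar>f x\<bar> \<le> Bf" "\<And>x. x \<in> {-1..1} \<Longrightarrow> \<bar>g x\<bar> \<le> Bg"
    using bounded[OF f] bounded[OF g] by blast
  have B0: "Bf \<ge> 0" "Bg \<ge> 0" using B[of 0] by auto
  show ?thesis
  proof (rule eq_if_norm_diff_le)
    fix e :: real assume e: "0 < e" "e \<le> 1"
    from polynomial_approximation[OF f e(1)] obtain p
      where p: "\<And>x. x \<in> {-1..1} \<Longrightarrow> \<bar>f x - poly p x\<bar> \<le> e" by blast
    from polynomial_approximation[OF g e(1)] obtain q
      where q: "\<And>x. x \<in> {-1..1} \<Longrightarrow> \<bar>g x - poly q x\<bar> \<le> e" by blast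
    have q': "\<bar>poly q x\<bar> \<le> Bg + 1" if "x \<in> {-1..1}" for x
      using q[OF that] B(2)[OF that] e by linarith
    \<comment> \<open>This bounds the distance from \<open>real_eval (p * q) s\<close> both of
      \<open>cfc s\<close> of the product and of the product of the \<open>cfc\<close> values. In
      each case one factor is replaced at a time.\<close>
    let ?K = "Bf * e + e * (Bg + 1)"
    have "norm (cfc s (\<lambda>x. f x * g x) - real_eval (p * q) s) \<le> ?K"
    proof (intro norm_cfc_diff_real_eval continuous_intros f g)
      fix x :: real assume x: "x \<in> {-1..1}"
      have "f x * g x - poly (p * q) x = f x * (g x - poly q x) + (f x - poly p x) * poly q x"
        by (simp add: algebra_simps)
      also have "\<bar>\<dots>\<bar> \<le> ?K"
        using p[OF x] q[OF x] q'[OF x] B(1)[OF x] B0 e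
        by (intro order.trans[OF abs_triangle_ineq] add_mono) (auto simp: abs_mult intro!: mult_mono)
      finally show "\<bar>f x * g x - poly (p * q) x\<bar> \<le> ?K" .
    qed
    moreover have "norm (cfc s f * cfc s g - real_eval (p * q) s) \<le> ?K"
    proof -
      have "cfc s f * cfc s g - real_eval (p * q) s =
          cfc s f * (cfc s g - real_eval q s) + (cfc s f - real_eval p s) * real_eval q s"
        by (simp add: real_eval_mult algebra_simps)
      also have "norm \<dots> \<le> ?K"
        using norm_cfc_le[OF f B(1)] norm_cfc_diff_real_eval[OF f p]
          norm_cfc_diff_real_eval[OF g q] norm_real_eval_le[OF selfadjoint contraction q'] B0 e
        by (intro order.trans[OF norm_triangle_ineq] add_mono
            order.trans[OF norm_mult_ineq] mult_mono) auto
      finally show ?thesis .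
    qed
    ultimately have "norm (cfc s (\<lambda>x. f x * g x) - cfc s f * cfc s g) \<le> ?K + ?K"
      using norm_triangle_ineq4[of "cfc s (\<lambda>x. f x * g x) - real_eval (p * q) s"
          "cfc s f * cfc s g - real_eval (p * q) s"] by simp
    then show "norm (cfc s (\<lambda>x. f x * g x) - cfc s f * cfc s g) \<le> (2 * (Bf + Bg + 1)) * e"
      by (simp add: algebra_simps)
  qed
qed

lemma cfc_power:
  assumes f: "continuous_on {-1..1} f"
  shows "cfc s (\<lambda>x. f x ^ n) = cfc s f ^ n"
  by (induction n) (simp_all add: cfc_const cfc_mult f continuous_intros)

end


section \<open>Square roots of \<open>w\<^sup>* w\<close>\<close>

lemma selfadjoint_square_eq_0:
  assumes "star x = x" "x * x = 0"
  shows "x = (0::'a::cstar_algebra)"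
  using cstar_identity[of x] assms by simp

text \<open>In this section, positivity of an element \<open>a\<close> is used in the form
  \<open>norm (1 - a) <= 1\<close>; here it is obtained for squares.\<close>

lemma norm_one_minus_square_le:
  fixes h :: "'a::unital_cstar_algebra"
  assumes "star h = h" "norm h < 1"
  shows "norm (1 - h * h) \<le> 1"
proof -
  have "\<bar>poly [:1, 0, -1:] x\<bar> \<le> 1" if "x \<in> {-1..1}" for x :: real
    using that abs_square_le_1[of x] by (auto simp: power2_eq_square abs_le_iff)
  from norm_real_eval_le[OF assms this] show ?thesis by simp
qed

text \<open>Replaces the usual comparison of the spectra of \<open>y\<^sup>* y\<close> and \<open>y y\<^sup>*\<close>: with \<open>y = h + i k\<close> and
  \<open>y\<^sup>* y = - S\<close>, the element \<open>y y\<^sup>* = 2 h\<^sup>2 + 2 k\<^sup>2 + S\<close> is positive, whence \<open>\<parallel>5 - y y\<^sup>*\<parallel> \<le> 5\<close>.\<close>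

lemma norm_mult_power_le:
  fixes y S :: "'a::unital_cstar_algebra"
  assumes yy: "star y * y = - S" and S: "norm (1 - S) \<le> 1" and y: "norm y < 1"
  shows "norm (y * (5 + S) ^ k) \<le> 5 ^ k"
proof -
  define H where "H = y + star y"
  define K where "K = y - star y"
  define h where "h = scaleC (1 / 2) H"
  define l where "l = scaleC (- \<i> / 2) K"
  have sa: "star h = h" "star l = l"
    by (simp_all add: h_def l_def H_def K_def star_scaleC star_add star_diff star_star add.commute
        scaleC_minus_left scaleC_diff_right)
  have "norm H \<le> norm y + norm (star y)" "norm K \<le> norm y + norm (star y)"
    unfolding H_def K_def by (rule norm_triangle_ineq norm_triangle_ineq4)+
  then have n: "norm h < 1" "norm l < 1"
    using y by (simp_all add: h_def l_def norm_scaleC norm_divide)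
  have "H * H - K * K = scaleC 2 (y * star y + star y * y)"
    using scaleC_add_left[of 1 1 "y * star y + star y * y"]
    by (simp add: H_def K_def algebra_simps)
  moreover have "h * h + l * l = scaleC (1 / 4) (H * H - K * K)"
    by (simp add: h_def l_def mult_scaleC_left mult_scaleC_right scaleC_scaleC scaleC_minus_left
        scaleC_minus_right scaleC_diff_right)
  ultimately have "h * h + l * l = scaleC (1 / 2) (y * star y + star y * y)"
    by (simp add: scaleC_scaleC)
  then have "(h * h + l * l) + (h * h + l * l) = y * star y + star y * y"
    by (simp flip: scaleC_add_left)
  \<comment> \<open>The number 5 counts the positive summands of \<open>y * star y\<close>: two
    copies of \<open>h * h\<close>, two of \<open>l * l\<close>, and \<open>S\<close>. Each is
    paired with its own 1.\<close>
  then have *: "5 - y * star y =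
      (1 - h * h) + ((1 - h * h) + ((1 - l * l) + ((1 - l * l) + (1 - S))))"
    using yy by (simp add: algebra_simps eq_neg_iff_add_eq_0)
  have "norm (5 - y * star y) \<le> 1 + (1 + (1 + (1 + 1)))"
    unfolding * using norm_one_minus_square_le[OF sa(1) n(1)] norm_one_minus_square_le[OF sa(2) n(2)] S
    by (intro order.trans[OF norm_triangle_ineq] add_mono)
  then have "norm ((5 - y * star y) ^ k) \<le> 5 ^ k"
    using norm_power_ineq[of "5 - y * star y" k] power_mono[of "norm (5 - y * star y)" 5 k] by simp
  \<comment> \<open>As \<open>S = - (star y * y)\<close>, moving \<open>5 + S\<close> from the right
    of \<open>y\<close> to the left turns it into \<open>5 - y * star y\<close>, whose powers were
    just bounded.\<close>
  moreover have "y * (5 + S) ^ k = (5 - y * star y) ^ k * y"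
  proof (induction k)
    case (Suc k)
    have "y * (5 + S) = (5 - y * star y) * y"
      using yy mult_of_nat_commute[of 5 y] by (simp add: algebra_simps mult.assoc)
    then show ?case
      by (simp add: power_commutes flip: mult.assoc Suc) (simp add: mult.assoc Suc)
  qed simp
  ultimately show ?thesis
    using norm_mult_ineq[of "(5 - y * star y) ^ k" y] mult_mono[of _ "5 ^ k" "norm y" 1] y
    by (smt (verit) norm_ge_zero mult.right_neutral zero_less_power)
qed

text \<open>It suffices that the negative part \<open>n\<close> of \<open>r = star w * w\<close>
  vanishes, since then \<open>r\<close> is the square of \<open>cfc r\<close> of
  \<open>sqrt (max x 0)\<close>. For \<open>y = w * n\<close> one gets
  \<open>star y * y = - S\<close> with \<open>S\<close> the cube of \<open>n\<close>. Positivity of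
  \<open>S\<close> would let \<open>y * (5 + S) ^ k\<close> outgrow \<open>5 ^ k\<close>, against
  \<open>norm_mult_power_le\<close>, unless \<open>S = 0\<close>.\<close>

lemma sqrt_star_mult_contraction:
  fixes w :: "'a::unital_cstar_algebra"
  assumes w: "norm w < 1"
  shows "\<exists>q. star q = q \<and> q * q = star w * w"
proof -
  define r where "r = star w * w"
  have "norm r < 1"
    using w by (simp add: r_def cstar_identity abs_square_less_1)
  then interpret selfadjoint_contraction r
    by unfold_locales (simp_all add: r_def star_mult star_star)
  define m where "m = (\<lambda>x::real. max (- x) 0)"
  have cm [continuous_intros]: "continuous_on A m" for A
    unfolding m_def by (intro continuous_intros)
  have m: "m x \<ge> 0" "x \<in> {-1..1} \<Longrightarrow> m x \<le> 1" for x by (auto simp: m_def)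
  define n where "n = cfc r m"
  define S where "S = cfc r (\<lambda>x. m x ^ 3)"
  define y where "y = w * n"
  have sn: "star n = n" "star S = S" by (simp_all add: n_def S_def star_cfc continuous_intros)
  have nn: "norm n \<le> 1"
    unfolding n_def by (rule norm_cfc_le) (use m in \<open>auto intro!: continuous_intros\<close>)
  have yy: "star y * y = - S"
  proof -
    have "star y * y = n * r * n"
      by (simp add: y_def r_def star_mult sn mult.assoc)
    also have "\<dots> = cfc r (\<lambda>x. m x * x * m x)"
      by (simp add: n_def cfc_mult cfc_ident continuous_intros)
    also have "\<dots> = cfc r (\<lambda>x. 0 - m x ^ 3)"
      by (rule cfc_cong) (auto simp: m_def max_def power3_eq_cube)
    also have "\<dots> = - S"
      unfolding S_def by (subst cfc_diff) (auto simp: cfc_const intro!: continuous_intros)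
    finally show ?thesis .
  qed
  have "norm (1 - S) \<le> 1"
  proof -
    have "1 - S = cfc r (\<lambda>x. 1 - m x ^ 3)"
      unfolding S_def by (subst cfc_diff) (auto simp: cfc_const intro!: continuous_intros)
    then show ?thesis
      using m by (auto intro!: norm_cfc_le continuous_intros simp: power_le_one)
  qed
  moreover have ny: "norm y < 1"
    using norm_mult_ineq[of w n] mult_mono[of "norm w" "norm w" "norm n" 1] w nn by (simp add: y_def)
  ultimately have le: "norm (y * (5 + S) ^ k) \<le> 5 ^ k" for k
    by (rule norm_mult_power_le[OF yy])
  have "S * S = 0"
  proof (rule norm_eq_0_if_le_divide)
    fix k :: nat assume k: "k \<ge> 1"
    \<comment> \<open>Multiplying by this function cancels \<open>(5 + S) ^ k\<close> and leaves a
      factor \<open>S\<close>. Bernoulli's inequality for \<open>(1 + t / 5) ^ k\<close> supplies a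
      decay of order \<open>1 / k\<close> beyond \<open>5 ^ k\<close>.\<close>
    let ?\<phi> = "\<lambda>x. m x ^ 3 / (5 + m x ^ 3) ^ k"
    have pos: "5 + m x ^ 3 > 0" for x using zero_le_power[OF m(1)[of x], of 3] by linarith
    have nz: "(5 + m x ^ 3) ^ k \<noteq> 0" for x using pos[of x] by (intro power_not_zero) linarith
    then have c\<phi>: "continuous_on {-1..1} ?\<phi>"
      by (intro continuous_on_divide continuous_intros) blast+
    have "\<bar>?\<phi> x\<bar> \<le> 5 / (real k * 5 ^ k)" for x
    proof -
      let ?t = "m x ^ 3"
      have t: "?t \<ge> 0" using m by simp
      have "1 + real k * (?t / 5) \<le> (1 + ?t / 5) ^ k"
        using t by (intro Bernoulli_inequality) linarith
      then have "5 ^ k * (real k * (?t / 5)) \<le> 5 ^ k * (1 + ?t / 5) ^ k"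
        by (intro mult_left_mono) auto
      also have "\<dots> = (5 * (1 + ?t / 5)) ^ k" by (rule power_mult_distrib[symmetric])
      also have "5 * (1 + ?t / 5) = 5 + ?t" by simp
      finally have le: "5 ^ k * (real k * (?t / 5)) \<le> (5 + ?t) ^ k" .
      have "?t = 5 / (real k * 5 ^ k) * (5 ^ k * (real k * (?t / 5)))" using k by simp
      also have "\<dots> \<le> 5 / (real k * 5 ^ k) * (5 + ?t) ^ k"
        by (intro mult_left_mono le) simp
      finally have "?\<phi> x \<le> 5 / (real k * 5 ^ k)"
        using pos[of x] by (subst pos_divide_le_eq) (rule zero_less_power, assumption)
      moreover have "?\<phi> x \<ge> 0" using t pos[of x] by (intro divide_nonneg_pos zero_less_power)
      ultimately show ?thesis by (simp only: abs_of_nonneg)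
    qed
    then have n\<phi>: "norm (cfc r ?\<phi>) \<le> 5 / (real k * 5 ^ k)"
      by (intro norm_cfc_le[OF c\<phi>])
    have c: "continuous_on {-1..1} (\<lambda>x. m x ^ 3)" "continuous_on {-1..1} (\<lambda>x. 5 + m x ^ 3)"
      "continuous_on {-1..1} (\<lambda>x. (5 + m x ^ 3) ^ k)"
      "continuous_on {-1..1} (\<lambda>x. m x ^ 3 * (5 + m x ^ 3) ^ k)"
      by (intro continuous_intros)+
    have S5: "5 + S = cfc r (\<lambda>x. 5 + m x ^ 3)"
      unfolding S_def by (subst cfc_add) (auto simp: cfc_const scaleR_conv_of_real intro!: continuous_intros)
    have "cfc r ?\<phi> * (S * (5 + S) ^ k) = cfc r (\<lambda>x. ?\<phi> x * (m x ^ 3 * (5 + m x ^ 3) ^ k))"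
      unfolding S5 unfolding S_def
      by (simp only: cfc_mult[OF c\<phi> c(4)] cfc_mult[OF c(1) c(3)] cfc_power[OF c(2)])
    also have "\<dots> = cfc r (\<lambda>x. m x ^ 3 * m x ^ 3)"
      by (rule cfc_cong) (use nz in simp)
    also have "\<dots> = S * S"
      unfolding S_def by (simp only: cfc_mult[OF c(1) c(1)])
    \<comment> \<open>The remaining \<open>S\<close> is replaced by \<open>- (star y * y)\<close>,
      so that the bound on \<open>y * (5 + S) ^ k\<close> applies.\<close>
    finally have SS: "S * S = - (cfc r ?\<phi> * (star y * (y * (5 + S) ^ k)))"
      by (simp add: yy flip: mult.assoc[of "star y"])
    have "norm (star y * (y * (5 + S) ^ k)) \<le> norm (star y) * norm (y * (5 + S) ^ k)"
      by (rule norm_mult_ineq)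
    also have "\<dots> \<le> 1 * 5 ^ k"
      using ny by (intro mult_mono le) auto
    finally have le': "norm (star y * (y * (5 + S) ^ k)) \<le> 1 * 5 ^ k" .
    have "norm (S * S) \<le> norm (cfc r ?\<phi>) * norm (star y * (y * (5 + S) ^ k))"
      unfolding SS norm_minus_cancel by (rule norm_mult_ineq)
    also have "\<dots> \<le> 5 / (real k * 5 ^ k) * (1 * 5 ^ k)"
      by (intro mult_mono n\<phi> le') auto
    also have "\<dots> = 5 / real k" by simp
    finally show "norm (S * S) \<le> 5 / real k" .
  qed
  then have "S = 0" by (rule selfadjoint_square_eq_0[OF sn(2)])
  have "n * n * (n * n) = n * S"
    unfolding n_def S_def cfc_power[OF cm] by (simp add: power3_eq_cube mult.assoc)
  then have "n * n = 0"
    using selfadjoint_square_eq_0[of "n * n"] by (simp add: star_mult sn \<open>S = 0\<close>)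
  then have "n = 0" by (rule selfadjoint_square_eq_0[OF sn(1)])
  let ?q = "cfc r (\<lambda>x. sqrt (max x 0))"
  have cq: "continuous_on {-1..1} (\<lambda>x::real. sqrt (max x 0))" by (intro continuous_intros)
  have "?q * ?q = cfc r (\<lambda>x. sqrt (max x 0) * sqrt (max x 0))"
    by (rule cfc_mult[OF cq cq, symmetric])
  also have "\<dots> = cfc r (\<lambda>x. x + m x)"
    by (rule cfc_cong) (auto simp: m_def max_def)
  also have "\<dots> = r + n"
    unfolding n_def by (subst cfc_add) (auto simp: cfc_ident intro!: continuous_intros)
  finally have "?q * ?q = star w * w" by (simp add: \<open>n = 0\<close> r_def)
  moreover have "star ?q = ?q" by (rule star_cfc[OF cq])
  ultimately show ?thesis by blast
qed

lemma sqrt_star_mult: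
  fixes w :: "'a::unital_cstar_algebra"
  obtains q where "star q = q" "q * q = star w * w"
proof -
  define t where "t = 1 / (norm w + 1)"
  have t: "t > 0" "t * norm w < 1" by (auto simp: t_def field_simps add_pos_nonneg)
  then have "norm (scaleR t w) < 1" by simp
  then obtain q where q: "star q = q" "q * q = star (scaleR t w) * scaleR t w"
    using sqrt_star_mult_contraction by blast
  have "scaleR (1 / t) q * scaleR (1 / t) q = scaleR (1 / t * (1 / t)) (q * q)"
    by simp
  also have "\<dots> = star w * w"
    unfolding q(2) using t by (simp add: star_scaleR)
  finally show ?thesis
    by (rule that[rotated]) (simp add: star_scaleR q(1))
qed


section \<open>Factorization through functions of a self-adjoint element\<close>

text \<open>The hypothesis on \<open>w\<close> says that \<open>w\<close> is dominated by the power
  3/2 of \<open>f\<close>. The spare square root of \<open>f\<close> makes the regularized quotients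
  of \<open>w\<close> by \<open>f\<close> converge in norm, although \<open>f\<close> may have
  zeros.\<close>

lemma (in selfadjoint_contraction) factorization:
  assumes f: "continuous_on {-1..1} f" "\<And>x. x \<in> {-1..1} \<Longrightarrow> 0 \<le> f x \<and> f x \<le> 1"
    and w: "\<And>\<phi> M. continuous_on {-1..1} \<phi> \<Longrightarrow>
      (\<And>x. x \<in> {-1..1} \<Longrightarrow> \<bar>f x * sqrt (f x) * \<phi> x\<bar> \<le> M) \<Longrightarrow> norm (w * cfc s \<phi>) \<le> C * M"
  obtains c where "w = c * cfc s f"
proof -
  define \<delta> where "\<delta> n = 1 / real (Suc n)" for n
  \<comment> \<open>A continuous substitute for the reciprocal of \<open>f\<close>; \<open>c\<close>
    will be the limit of \<open>w * cfc s (g n)\<close>.\<close>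
  define g where "g n x = 1 / (f x + (\<delta> n)\<^sup>2)" for n x
  have \<delta>: "\<delta> n > 0" for n by (simp add: \<delta>_def)
  have lim: "\<delta> \<longlonglongrightarrow> 0"
    unfolding \<delta>_def using LIMSEQ_Suc[OF lim_const_over_n[of 1]] by simp
  have pos: "f x + (\<delta> n)\<^sup>2 > 0" if "x \<in> {-1..1}" for n x
    using f(2)[OF that] \<delta>[of n] by (intro add_nonneg_pos) auto
  have cg: "continuous_on {-1..1} (g n)" for n
    unfolding g_def using pos[of _ n]
    by (auto intro!: continuous_intros f simp: less_imp_neq[symmetric])
  have fg: "f x * g n x = 1 - (\<delta> n)\<^sup>2 * g n x" if "x \<in> {-1..1}" for n x
    using pos[OF that, of n] by (simp add: g_def field_simps)
  \<comment> \<open>By the arithmetic-geometric mean inequality,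
    \<open>sqrt (f x) * \<delta> n\<close> is at most the denominator of \<open>g n x\<close>. This
    controls the error \<open>1 - f x * g n x\<close> after multiplication by
    \<open>sqrt (f x)\<close>, uniformly in \<open>x\<close>.\<close>
  have bound: "0 \<le> sqrt (f x) * ((\<delta> n)\<^sup>2 * g n x) \<and> sqrt (f x) * ((\<delta> n)\<^sup>2 * g n x) \<le> \<delta> n"
    if x: "x \<in> {-1..1}" for n x
  proof
    show "0 \<le> sqrt (f x) * ((\<delta> n)\<^sup>2 * g n x)"
      using pos[OF x, of n] f(2)[OF x] by (simp add: g_def)
    have "0 \<le> (sqrt (f x) - \<delta> n)\<^sup>2" by simp
    also have "\<dots> = f x + (\<delta> n)\<^sup>2 - 2 * (sqrt (f x) * \<delta> n)"
      using f(2)[OF x] by (simp add: power2_diff)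
    finally have "2 * (sqrt (f x) * \<delta> n) \<le> f x + (\<delta> n)\<^sup>2" by simp
    moreover have "0 \<le> sqrt (f x) * \<delta> n"
      using f(2)[OF x] \<delta>[of n] by simp
    ultimately have "sqrt (f x) * \<delta> n \<le> f x + (\<delta> n)\<^sup>2" by linarith
    then have "\<delta> n * (sqrt (f x) * \<delta> n) \<le> \<delta> n * (f x + (\<delta> n)\<^sup>2)"
      using \<delta>[of n] by (intro mult_left_mono) auto
    then show "sqrt (f x) * ((\<delta> n)\<^sup>2 * g n x) \<le> \<delta> n"
      using pos[OF x, of n] by (simp add: g_def pos_divide_le_eq power2_eq_square mult_ac)
  qed
  have diff: "norm (w * cfc s (g m) - w * cfc s (g n)) \<le> C * (\<delta> m + \<delta> n)" for m n
  proof -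
    have "\<bar>f x * sqrt (f x) * (g m x - g n x)\<bar> \<le> \<delta> m + \<delta> n" if x: "x \<in> {-1..1}" for x
    proof -
      have "f x * sqrt (f x) * (g m x - g n x) = sqrt (f x) * (f x * g m x - f x * g n x)"
        by (simp add: algebra_simps)
      also have "\<dots> = sqrt (f x) * ((\<delta> n)\<^sup>2 * g n x) - sqrt (f x) * ((\<delta> m)\<^sup>2 * g m x)"
        by (simp add: fg[OF x] algebra_simps)
      finally show ?thesis using bound[OF x, of m] bound[OF x, of n] by linarith
    qed
    then have "norm (w * cfc s (\<lambda>x. g m x - g n x)) \<le> C * (\<delta> m + \<delta> n)"
      by (intro w continuous_intros cg)
    then show ?thesis by (simp add: cfc_diff cg algebra_simps)
  qed
  have C: "C \<ge> 0"
    using order.trans[OF norm_ge_zero diff[of 0 0]] \<delta>[of 0] by (simp add: zero_le_mult_iff)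
  have "Cauchy (\<lambda>n. w * cfc s (g n))"
  proof (rule CauchyI)
    fix e :: real assume "e > 0"
    have "(\<lambda>n. C * \<delta> n) \<longlonglongrightarrow> C * 0" by (intro tendsto_intros lim)
    then obtain N where N: "\<And>n. n \<ge> N \<Longrightarrow> C * \<delta> n < e / 2"
      using order_tendstoD(2)[of _ "C * 0" sequentially "e / 2"] \<open>e > 0\<close>
      by (auto simp: eventually_sequentially)
    have "norm (w * cfc s (g m) - w * cfc s (g n)) < e" if "m \<ge> N" "n \<ge> N" for m n
      using diff[of m n] N[OF that(1)] N[OF that(2)] by (simp add: algebra_simps)
    then show "\<exists>M. \<forall>m\<ge>M. \<forall>n\<ge>M. norm (w * cfc s (g m) - w * cfc s (g n)) < e" by blast
  qed
  then obtain c where c: "(\<lambda>n. w * cfc s (g n)) \<longlonglongrightarrow> c"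
    by (auto simp: Cauchy_convergent_iff convergent_def)
  have rest: "norm (w - w * cfc s (g n) * cfc s f) \<le> C * \<delta> n" for n
  proof -
    have "\<bar>f x * sqrt (f x) * (1 - g n x * f x)\<bar> \<le> \<delta> n" if x: "x \<in> {-1..1}" for x
    proof -
      have "f x * sqrt (f x) * (1 - g n x * f x) = f x * (sqrt (f x) * ((\<delta> n)\<^sup>2 * g n x))"
        by (simp add: fg[OF x] mult.commute[of _ "f x"])
      also have "\<bar>\<dots>\<bar> \<le> 1 * \<delta> n"
        using f(2)[OF x] bound[OF x, of n] unfolding abs_mult by (intro mult_mono) auto
      finally show ?thesis by simp
    qed
    then have "norm (w * cfc s (\<lambda>x. 1 - g n x * f x)) \<le> C * \<delta> n"
      by (intro w continuous_intros cg f)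
    moreover have "cfc s (\<lambda>x. 1 - g n x * f x) = 1 - cfc s (g n) * cfc s f"
      by (subst cfc_diff) (auto simp: cfc_const cfc_mult cg f intro!: continuous_intros)
    ultimately show ?thesis by (simp only: right_diff_distrib mult_1_right mult.assoc)
  qed
  have "(\<lambda>n. C * \<delta> n) \<longlonglongrightarrow> 0" using tendsto_mult_right_zero[OF lim] .
  then have "(\<lambda>n. w - w * cfc s (g n) * cfc s f) \<longlonglongrightarrow> 0"
    by (rule Lim_null_comparison[OF always_eventually[OF allI[OF rest]]])
  moreover have "(\<lambda>n. w - w * cfc s (g n) * cfc s f) \<longlonglongrightarrow> w - c * cfc s f"
    by (intro tendsto_intros c)
  ultimately have "w - c * cfc s f = 0" by (rule LIMSEQ_unique[rotated])
  then have "w = c * cfc s f" by simp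
  then show ?thesis by (rule that)
qed


section \<open>Semiprime ideals of unital C*-algebras\<close>

locale semiprime_ideal =
  fixes Q :: "'a::unital_cstar_algebra set"
  assumes add: "x \<in> Q \<Longrightarrow> y \<in> Q \<Longrightarrow> x + y \<in> Q"
    and left: "x \<in> Q \<Longrightarrow> a * x \<in> Q"
    and right: "x \<in> Q \<Longrightarrow> x * a \<in> Q"
    and semiprime: "(\<And>b. x * b * x \<in> Q) \<Longrightarrow> x \<in> Q"
begin

lemma scaleC: "x \<in> Q \<Longrightarrow> scaleC c x \<in> Q"
  using left[of x "scaleC c 1"] by (simp add: mult_scaleC_left)

lemma scaleR: "x \<in> Q \<Longrightarrow> scaleR r x \<in> Q"
  by (simp add: scaleR_scaleC scaleC)

lemma diff: "x \<in> Q \<Longrightarrow> y \<in> Q \<Longrightarrow> x - y \<in> Q"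
  using add[of x "scaleR (-1) y"] scaleR[of y "-1"] by simp

text \<open>Polarization: for self-adjoint \<open>b\<close>, the difference of the squares of
  \<open>1 + b\<close> and \<open>1 - b\<close> is \<open>4 b\<close>. A general \<open>b\<close> is
  a complex combination of two self-adjoint elements.\<close>

lemma semiprime_squares:
  assumes "\<And>d. star d = d \<Longrightarrow> x * (d * d) * x \<in> Q"
  shows "x \<in> Q"
proof (rule semiprime)
  have sa: "x * b * x \<in> Q" if b: "star b = b" for b
  proof -
    have "x * ((1 + b) * (1 + b)) * x - x * ((1 - b) * (1 - b)) * x \<in> Q"
      by (intro diff assms) (simp_all add: star_add star_diff b)
    moreover have "x * ((1 + b) * (1 + b)) * x - x * ((1 - b) * (1 - b)) * x =
        scaleR 2 (scaleR 2 (x * b * x))"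
      unfolding scaleR_2 by (simp add: algebra_simps)
    ultimately have "scaleR (1 / 4) (scaleR 2 (scaleR 2 (x * b * x))) \<in> Q"
      by (simp only: scaleR)
    then show ?thesis by simp
  qed
  fix b :: 'a
  define b1 where "b1 = b + star b"
  define b2 where "b2 = scaleC \<i> (b - star b)"
  have "star b1 = b1" "star b2 = b2"
    by (simp_all add: b1_def b2_def star_add star_diff star_scaleC star_star add.commute
        scaleC_minus_left scaleC_diff_right)
  then have "scaleC (1 / 2) (x * b1 * x) - scaleC (\<i> / 2) (x * b2 * x) \<in> Q"
    by (intro diff scaleC sa)
  moreover have b: "scaleC (1 / 2) b1 - scaleC (\<i> / 2) b2 = b"
    by (simp add: b1_def b2_def scaleC_scaleC scaleC_minus_left flip: scaleC_add_right)
       (simp add: scaleC_add_right[of _ b b] flip: scaleC_add_left)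
  have "x * b * x = scaleC (1 / 2) (x * b1 * x) - scaleC (\<i> / 2) (x * b2 * x)"
    unfolding b[symmetric] by (simp add: algebra_simps mult_scaleC_left mult_scaleC_right)
  ultimately show "x * b * x \<in> Q" by simp
qed

text \<open>For \<open>e = f\<^bsup>3/2\<^esup>\<close> the square root \<open>q\<close> of \<open>e d\<^sup>2 e\<close> is divisible by \<open>f\<close>, hence \<open>e d\<^sup>2 e = q q\<^sup>*\<close>
  lies in the ideal generated by \<open>f\<^sup>2\<close>.\<close>

lemma cfc_square_imp_cfc_three_halves:
  assumes "star s = s" "norm s < 1"
    and f: "continuous_on {-1..1} f" "\<And>x. x \<in> {-1..1} \<Longrightarrow> 0 \<le> f x \<and> f x \<le> 1"
    and Q: "cfc s (\<lambda>x. f x * f x) \<in> Q"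
  shows "cfc s (\<lambda>x. f x * sqrt (f x)) \<in> Q"
proof (rule semiprime_squares)
  interpret selfadjoint_contraction s by unfold_locales fact+
  let ?e = "cfc s (\<lambda>x. f x * sqrt (f x))"
  have ce: "continuous_on {-1..1} (\<lambda>x. f x * sqrt (f x))" by (intro continuous_intros f)
  fix d :: 'a assume d: "star d = d"
  obtain q where q: "star q = q" "q * q = star (d * ?e) * (d * ?e)" by (rule sqrt_star_mult)
  have "norm (q * cfc s \<phi>) \<le> norm d * M"
    if \<phi>: "continuous_on {-1..1} \<phi>" and M: "\<And>x. x \<in> {-1..1} \<Longrightarrow> \<bar>f x * sqrt (f x) * \<phi> x\<bar> \<le> M"
    for \<phi> M
  proof -
    \<comment> \<open>Since \<open>q * q = star (d * ?e) * (d * ?e)\<close>, the C*-identity gives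
      \<open>q\<close> and \<open>d * ?e\<close> the same norm after right multiplication by
      \<open>cfc s \<phi>\<close>.\<close>
    have "star (q * cfc s \<phi>) * (q * cfc s \<phi>) = star (cfc s \<phi>) * (q * q) * cfc s \<phi>"
      by (simp add: star_mult q(1) mult.assoc)
    also have "\<dots> = star (d * ?e * cfc s \<phi>) * (d * ?e * cfc s \<phi>)"
      unfolding q(2) by (simp add: star_mult mult.assoc)
    finally have "norm (q * cfc s \<phi>) = norm (d * ?e * cfc s \<phi>)"
      using cstar_identity[of "q * cfc s \<phi>"] cstar_identity[of "d * ?e * cfc s \<phi>"] by simp
    also have "d * ?e * cfc s \<phi> = d * cfc s (\<lambda>x. f x * sqrt (f x) * \<phi> x)"
      by (simp only: cfc_mult[OF ce \<phi>]) (simp only: mult.assoc)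
    also have "norm \<dots> \<le> norm d * M"
      by (intro order.trans[OF norm_mult_ineq] mult_left_mono norm_cfc_le continuous_intros f \<phi> M) auto
    finally show ?thesis .
  qed
  from factorization[OF f this] obtain c where c: "q = c * cfc s f" by blast
  have "?e * (d * d) * ?e = star (d * ?e) * (d * ?e)"
    by (simp add: star_mult d star_cfc[OF ce] mult.assoc)
  also have "\<dots> = q * star q" by (simp add: q)
  also have "\<dots> = c * (cfc s f * cfc s f) * star c"
    by (simp add: c star_mult star_cfc f mult.assoc)
  finally have "?e * (d * d) * ?e = c * (cfc s f * cfc s f) * star c" .
  moreover have "cfc s f * cfc s f \<in> Q" using Q by (simp add: cfc_mult f)
  ultimately show "?e * (d * d) * ?e \<in> Q" by (simp add: left right)
qed

text \<open>Passing from the square of \<open>f\<close> to its power 3/2 multiplies the exponent by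
  3/4. Iteration brings it below \<open>\<gamma>\<close>, and multiplication by a further power of
  the absolute value raises it to \<open>\<gamma>\<close> exactly.\<close>

lemma cfc_abs_powr:
  assumes s: "star s = s" "norm s < 1"
    and "\<beta> > 0" "cfc s (\<lambda>x. \<bar>x\<bar> powr \<beta>) \<in> Q" "\<gamma> > 0"
  shows "cfc s (\<lambda>x. \<bar>x\<bar> powr \<gamma>) \<in> Q"
proof -
  interpret selfadjoint_contraction s by unfold_locales fact+
  have cont: "continuous_on {-1..1} (\<lambda>x::real. \<bar>x\<bar> powr \<alpha>)" if "\<alpha> > 0" for \<alpha>
    using that by (intro continuous_on_powr' continuous_intros) auto
  have step: "cfc s (\<lambda>x. \<bar>x\<bar> powr (\<alpha> * (3 / 4))) \<in> Q"
    if \<alpha>: "\<alpha> > 0" "cfc s (\<lambda>x. \<bar>x\<bar> powr \<alpha>) \<in> Q" for \<alpha>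
  proof -
    let ?f = "\<lambda>x::real. \<bar>x\<bar> powr (\<alpha> / 2)"
    have eq: "\<bar>x\<bar> powr \<alpha> = ?f x * ?f x" "\<bar>x\<bar> powr (\<alpha> * (3 / 4)) = ?f x * sqrt (?f x)" for x
      by (simp_all add: powr_half_sqrt[symmetric] powr_powr mult.commute flip: powr_add)
    show ?thesis
      unfolding eq using \<alpha> unfolding eq
      by (intro cfc_square_imp_cfc_three_halves s cont) (auto intro!: powr_le1)
  qed
  have "\<beta> * (3 / 4) ^ k > 0 \<and> cfc s (\<lambda>x. \<bar>x\<bar> powr (\<beta> * (3 / 4) ^ k)) \<in> Q" for k
  proof (induction k)
    case (Suc k)
    then show ?case using step[of "\<beta> * (3 / 4) ^ k"] by (simp add: mult_ac)
  qed (use assms in simp)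
  moreover obtain k where k: "(3 / 4) ^ k < \<gamma> / \<beta>"
    using real_arch_pow_inv[of "\<gamma> / \<beta>" "3 / 4"] assms by auto
  ultimately obtain \<alpha> where \<alpha>: "0 < \<alpha>" "\<alpha> < \<gamma>" "cfc s (\<lambda>x. \<bar>x\<bar> powr \<alpha>) \<in> Q"
    using assms that[of "\<beta> * (3 / 4) ^ k"] by (auto simp: field_simps)
  have "cfc s (\<lambda>x. \<bar>x\<bar> powr \<gamma>) = cfc s (\<lambda>x. \<bar>x\<bar> powr (\<gamma> - \<alpha>) * \<bar>x\<bar> powr \<alpha>)"
    by (simp flip: powr_add)
  also have "\<dots> = cfc s (\<lambda>x. \<bar>x\<bar> powr (\<gamma> - \<alpha>)) * cfc s (\<lambda>x. \<bar>x\<bar> powr \<alpha>)"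
    using \<alpha> by (intro cfc_mult cont) auto
  finally show ?thesis using \<alpha> left by simp
qed

lemma power_star_mult_contraction:
  assumes x: "norm x < 1" and n: "n \<ge> 1" "(star x * x) ^ n \<in> Q"
  shows "x \<in> Q"
proof -
  define s where "s = star x * x"
  have s: "star s = s" "norm s < 1"
    using x by (simp_all add: s_def star_mult star_star cstar_identity abs_square_less_1)
  interpret selfadjoint_contraction s by unfold_locales fact+
  \<comment> \<open>The exponent is doubled because \<open>cfc\<close> sees all of
    \<open>{-1..1}\<close>: an even power agrees with the power of the absolute value at negative
    points too.\<close>
  have "cfc s (\<lambda>x. \<bar>x\<bar> powr real (2 * n)) = cfc s (\<lambda>x. x ^ (2 * n))"
  proof (rule cfc_cong)
    fix x :: real
    show "\<bar>x\<bar> powr real (2 * n) = x ^ (2 * n)"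
      using n(1) by (subst powr_realpow') (auto simp: power_even_abs)
  qed
  also have "\<dots> = s ^ n * s ^ n"
    using cfc_power[of "\<lambda>x. x" "2 * n"] by (simp add: cfc_ident mult_2 power_add)
  finally have "cfc s (\<lambda>x. \<bar>x\<bar> powr real (2 * n)) \<in> Q"
    using n left by (simp add: s_def)
  then have F: "cfc s (\<lambda>x. \<bar>x\<bar> powr (1 / 3)) \<in> Q"
    by (rule cfc_abs_powr[OF s, rotated]) (use n(1) in auto)
  \<comment> \<open>With exponent 1/3, the power 3/2 of \<open>?f\<close> is the square root of the
    absolute value. This is what dominates \<open>x\<close>, because
    \<open>star x * x = s\<close>.\<close>
  let ?f = "\<lambda>x::real. \<bar>x\<bar> powr (1 / 3)"
  have f: "continuous_on {-1..1} ?f"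
    by (intro continuous_on_powr' continuous_intros) auto
  have f1: "0 \<le> ?f x \<and> ?f x \<le> 1" if "x \<in> {-1..1}" for x
    using that by (auto intro!: powr_le1)
  have "norm (x * cfc s \<phi>) \<le> 1 * M"
    if \<phi>: "continuous_on {-1..1} \<phi>" and M: "\<And>x. x \<in> {-1..1} \<Longrightarrow> \<bar>?f x * sqrt (?f x) * \<phi> x\<bar> \<le> M"
    for \<phi> M
  proof -
    have M0: "M \<ge> 0" using M[of 0] by simp
    have "star (x * cfc s \<phi>) * (x * cfc s \<phi>) = cfc s \<phi> * s * cfc s \<phi>"
      by (simp only: star_mult star_cfc[OF \<phi>]) (simp only: s_def mult.assoc)
    also have "\<dots> = cfc s (\<lambda>x. \<phi> x * x * \<phi> x)"
      by (simp add: cfc_mult cfc_ident \<phi> continuous_intros)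
    finally have "(norm (x * cfc s \<phi>))\<^sup>2 = norm (cfc s (\<lambda>x. \<phi> x * x * \<phi> x))"
      by (simp flip: cstar_identity)
    also have "\<dots> \<le> M\<^sup>2"
    proof (intro norm_cfc_le continuous_intros \<phi>)
      fix x :: real assume x: "x \<in> {-1..1}"
      have "?f x * sqrt (?f x) = \<bar>x\<bar> powr (1 / 2)"
        by (simp add: powr_half_sqrt[symmetric] powr_powr flip: powr_add)
      then have "\<bar>sqrt \<bar>x\<bar> * \<phi> x\<bar> \<le> M" using M[OF x] by (simp add: powr_half_sqrt)
      then have "(sqrt \<bar>x\<bar> * \<phi> x)\<^sup>2 \<le> M\<^sup>2" by (rule abs_le_square_iff[THEN iffD1, OF order.trans]) simp
      then show "\<bar>\<phi> x * x * \<phi> x\<bar> \<le> M\<^sup>2"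
        by (simp add: power_mult_distrib abs_mult power2_eq_square mult_ac)
    qed
    finally show ?thesis using M0 by (simp add: power2_le_iff_abs_le)
  qed
  from factorization[OF f f1 this] obtain c where "x = c * cfc s ?f"
    by blast
  then show ?thesis using F left by simp
qed

lemma power_star_mult_imp:
  assumes n: "n \<ge> 1" "(star x * x) ^ n \<in> Q"
  shows "x \<in> Q"
proof -
  define t where "t = 1 / (norm x + 1)"
  have t: "t > 0" "t * norm x < 1" by (auto simp: t_def field_simps add_pos_nonneg)
  have "star (scaleR t x) * scaleR t x = scaleR (t * t) (star x * x)"
    by (simp add: star_scaleR)
  then have "(star (scaleR t x) * scaleR t x) ^ n \<in> Q"
    using n by (simp add: scaleR_power scaleR del: mult_scaleR_left mult_scaleR_right)
  with t n(1) have "scaleR t x \<in> Q"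
    by (intro power_star_mult_contraction[of "scaleR t x" n]) simp_all
  then show ?thesis using scaleR[of "scaleR t x" "1 / t"] t by simp
qed

text \<open>Regrouping factors, \<open>(star x * x) ^ Suc n\<close> equals
  \<open>(x * star x) ^ n\<close> between \<open>star x\<close> and \<open>x\<close>, which reduces
  the claim to the other order.\<close>

lemma power_mult_star_imp:
  assumes n: "n \<ge> 1" "(x * star x) ^ n \<in> Q"
  shows "x \<in> Q"
proof (rule power_star_mult_imp)
  have "(star x * x) ^ Suc n = star x * (x * star x) ^ n * x"
  proof (induction n)
    case (Suc n)
    then show ?case by (simp only: power_Suc[of _ "Suc n"]) (simp add: mult.assoc)
  qed simp
  then show "(star x * x) ^ Suc n \<in> Q" using n by (simp only: left right)
qed simp

end


section \<open>Prime ideals in rings without identity\<close>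

context nonunital_ring
begin

lemma two_sided_idealI:
  assumes "L \<subseteq> carrier R" "\<zero> \<in> L" "\<And>x y. x \<in> L \<Longrightarrow> y \<in> L \<Longrightarrow> x \<oplus> y \<in> L"
    and "\<And>x. x \<in> L \<Longrightarrow> \<ominus> x \<in> L"
    and "\<And>a x. a \<in> carrier R \<Longrightarrow> x \<in> L \<Longrightarrow> a \<otimes> x \<in> L"
    and "\<And>a x. a \<in> carrier R \<Longrightarrow> x \<in> L \<Longrightarrow> x \<otimes> a \<in> L"
  shows "two_sided_ideal L R"
proof -
  have "additive_subgroup L R"
    by (intro additive_subgroupI subgroup.intro) (use assms(1-4) in \<open>auto simp flip: a_inv_def\<close>)
  then show ?thesis
    using assms(5,6) by (simp add: two_sided_ideal_def left_ideal_def right_ideal_def)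
qed

lemma two_sided_ideal_carrier: "two_sided_ideal (carrier R) R"
  by (intro two_sided_idealI) (auto simp: mult_closed)

text \<open>Lets primeness be tested on products of single elements instead of generated
  subgroups.\<close>

lemma ideal_product_subset_iff:
  assumes P: "two_sided_ideal P R" and L: "L \<subseteq> carrier R" "L' \<subseteq> carrier R"
  shows "ideal_product R L L' \<subseteq> P \<longleftrightarrow> (\<forall>x\<in>L. \<forall>y\<in>L'. x \<otimes> y \<in> P)"
proof
  assume *: "\<forall>x\<in>L. \<forall>y\<in>L'. x \<otimes> y \<in> P"
  have "group (add_monoid R)" by (rule a_group)
  moreover have "subgroup P (add_monoid R)"
    using two_sided_idealD(1)[OF P] by (simp add: additive_subgroup_def)
  ultimately show "ideal_product R L L' \<subseteq> P"
    unfolding ideal_product_def using * by (intro group.generate_subgroup_incl) auto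
next
  assume "ideal_product R L L' \<subseteq> P"
  then show "\<forall>x\<in>L. \<forall>y\<in>L'. x \<otimes> y \<in> P"
    unfolding ideal_product_def by (blast intro: generate.incl)
qed

lemma prime_idealD:
  assumes "prime_ideal P R"
  shows "two_sided_ideal P R" "P \<noteq> carrier R"
    and "\<And>L L'. two_sided_ideal L R \<Longrightarrow> two_sided_ideal L' R \<Longrightarrow>
      (\<And>x y. x \<in> L \<Longrightarrow> y \<in> L' \<Longrightarrow> x \<otimes> y \<in> P) \<Longrightarrow> L \<subseteq> P \<or> L' \<subseteq> P"
  using assms by (auto simp: prime_ideal_def ideal_product_subset_iff two_sided_idealD(2))

lemma prime_idealI:
  assumes "two_sided_ideal P R" "P \<noteq> carrier R"
    and "\<And>L L'. two_sided_ideal L R \<Longrightarrow> two_sided_ideal L' R \<Longrightarrow>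
      (\<And>x y. x \<in> L \<Longrightarrow> y \<in> L' \<Longrightarrow> x \<otimes> y \<in> P) \<Longrightarrow> L \<subseteq> P \<or> L' \<subseteq> P"
  shows "prime_ideal P R"
  unfolding prime_ideal_def
proof (intro conjI allI impI assms(1,2))
  fix L L'
  assume *: "two_sided_ideal L R \<and> two_sided_ideal L' R \<and> ideal_product R L L' \<subseteq> P"
  then have "\<forall>x\<in>L. \<forall>y\<in>L'. x \<otimes> y \<in> P"
    using ideal_product_subset_iff[OF assms(1)] two_sided_idealD(2) by blast
  then show "L \<subseteq> P \<or> L' \<subseteq> P" using assms(3) * by blast
qed

text \<open>Closure of \<open>X\<close> under right multiplication is what absorbs left factors of
  \<open>y\<close>, by
  \<open>z \<otimes> (a \<otimes> y) = (z \<otimes> a) \<otimes> y\<close>.\<close>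

lemma two_sided_ideal_right_quotient:
  assumes P: "two_sided_ideal P R" and X: "X \<subseteq> carrier R"
    and "\<And>z a. z \<in> X \<Longrightarrow> a \<in> carrier R \<Longrightarrow> z \<otimes> a \<in> X"
  shows "two_sided_ideal {y \<in> carrier R. \<forall>z\<in>X. z \<otimes> y \<in> P} R"
proof (intro two_sided_idealI)
  note D = two_sided_idealD[OF P]
  show "\<zero> \<in> {y \<in> carrier R. \<forall>z\<in>X. z \<otimes> y \<in> P}"
    using X D(3) by (auto simp: mult_zero subset_iff)
qed (use X assms(3) two_sided_idealD[OF P] in
    \<open>auto simp: mult_closed distrib_l mult_minus subset_iff simp flip: mult_assoc\<close>)

lemma two_sided_ideal_left_quotient:
  assumes P: "two_sided_ideal P R" and X: "X \<subseteq> carrier R"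
    and "\<And>z a. z \<in> X \<Longrightarrow> a \<in> carrier R \<Longrightarrow> a \<otimes> z \<in> X"
  shows "two_sided_ideal {y \<in> carrier R. \<forall>z\<in>X. y \<otimes> z \<in> P} R"
proof (intro two_sided_idealI)
  note D = two_sided_idealD[OF P]
  show "\<zero> \<in> {y \<in> carrier R. \<forall>z\<in>X. y \<otimes> z \<in> P}"
    using X D(3) by (auto simp: zero_mult subset_iff)
qed (use X assms(3) two_sided_idealD[OF P] in
    \<open>auto simp: mult_closed distrib_r minus_mult subset_iff mult_assoc\<close>)

text \<open>A substitute for the identity: the elements sent into \<open>P\<close> by all left
  multiplications form an ideal whose product with the whole ring lies in \<open>P\<close>, and the
  whole ring is not contained in \<open>P\<close>.\<close>

lemma prime_ideal_left_cancel:
  assumes P: "prime_ideal P R" and x: "x \<in> carrier R" "\<And>a. a \<in> carrier R \<Longrightarrow> a \<otimes> x \<in> P"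
  shows "x \<in> P"
proof -
  note D = prime_idealD[OF P]
  have "two_sided_ideal {y \<in> carrier R. \<forall>z\<in>carrier R. z \<otimes> y \<in> P} R"
    by (intro two_sided_ideal_right_quotient D) (auto simp: mult_closed)
  from D(3)[OF two_sided_ideal_carrier this] D(2) two_sided_idealD(2)[OF D(1)] x
  show ?thesis by auto
qed

lemma prime_ideal_right_cancel:
  assumes P: "prime_ideal P R" and x: "x \<in> carrier R" "\<And>a. a \<in> carrier R \<Longrightarrow> x \<otimes> a \<in> P"
  shows "x \<in> P"
proof -
  note D = prime_idealD[OF P]
  have "two_sided_ideal {y \<in> carrier R. \<forall>z\<in>carrier R. y \<otimes> z \<in> P} R"
    by (intro two_sided_ideal_left_quotient D) (auto simp: mult_closed)
  from D(3)[OF this two_sided_ideal_carrier] D(2) two_sided_idealD(2)[OF D(1)] x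
  show ?thesis by auto
qed

text \<open>Two successive annihilators modulo \<open>P\<close> produce ideals with
  \<open>M N\<close> inside \<open>P\<close>, where \<open>x\<close> lies in \<open>N\<close> and
  all \<open>x \<otimes> a\<close> lie in \<open>M\<close>. If \<open>M\<close> is the one inside
  \<open>P\<close>, right cancellation still gives \<open>x \<in> P\<close>.\<close>

lemma prime_ideal_semiprime:
  assumes P: "prime_ideal P R" and x: "x \<in> carrier R"
    and xax: "\<And>a. a \<in> carrier R \<Longrightarrow> x \<otimes> a \<otimes> x \<in> P"
  shows "x \<in> P"
proof -
  note D = prime_idealD[OF P]
  define X where "X = (\<lambda>a. x \<otimes> a) ` carrier R"
  define N where "N = {y \<in> carrier R. \<forall>z\<in>X. z \<otimes> y \<in> P}"
  define M where "M = {y \<in> carrier R. \<forall>z\<in>N. y \<otimes> z \<in> P}"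
  have N: "two_sided_ideal N R"
    unfolding N_def by (intro two_sided_ideal_right_quotient D)
      (use x in \<open>auto simp: X_def mult_closed mult_assoc\<close>)
  have M: "two_sided_ideal M R"
    unfolding M_def using two_sided_idealD[OF N] by (intro two_sided_ideal_left_quotient D) auto
  have "x \<in> N" using x xax by (auto simp: N_def X_def)
  moreover have "X \<subseteq> M" using x by (auto simp: M_def N_def X_def mult_closed)
  moreover have "M \<subseteq> P \<or> N \<subseteq> P" by (rule D(3)[OF M N]) (auto simp: M_def)
  ultimately show ?thesis
    using prime_ideal_right_cancel[OF P x] by (auto simp: X_def)
qed

section \<open>Zorn's lemma and nilpotency of the lower nilradical\<close>

lemma two_sided_ideal_chain_Union:
  assumes "C \<noteq> {}" "\<And>L. L \<in> C \<Longrightarrow> two_sided_ideal L R" "\<And>L L'. L \<in> C \<Longrightarrow> L' \<in> C \<Longrightarrow> L \<subseteq> L' \<or> L' \<subseteq> L"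
  shows "two_sided_ideal (\<Union>C) R"
proof (intro two_sided_idealI)
  note D = two_sided_idealD[OF assms(2)]
  show "\<Union>C \<subseteq> carrier R" "\<zero> \<in> \<Union>C" using D assms(1) by auto
  show "x \<oplus> y \<in> \<Union>C" if "x \<in> \<Union>C" "y \<in> \<Union>C" for x y
  proof -
    from that obtain L L' where L: "L \<in> C" "x \<in> L" "L' \<in> C" "y \<in> L'" by blast
    with assms(3) obtain M where "M \<in> C" "x \<in> M" "y \<in> M" by blast
    then show ?thesis using D(4) by blast
  qed
  show "\<ominus> x \<in> \<Union>C" if "x \<in> \<Union>C" for x
    using that D(5) by auto
  fix a x assume a: "a \<in> carrier R" and "x \<in> \<Union>C"
  then obtain L where L: "L \<in> C" "x \<in> L" by blast
  show "a \<otimes> x \<in> \<Union>C" "x \<otimes> a \<in> \<Union>C"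
    using D(6)[OF L(1) a L(2)] D(7)[OF L(1) a L(2)] L(1) by blast+
qed

text \<open>By Zorn's lemma: an ideal maximal among those that contain no power of \<open>x\<close> is prime.\<close>

lemma exists_prime_ideal_avoiding_powers:
  assumes x: "x \<in> carrier R" and nil: "\<And>n. n \<ge> 1 \<Longrightarrow> pos_pow R x n \<noteq> \<zero>"
  obtains P where "prime_ideal P R" "x \<notin> P"
proof -
  define F where "F = {L. two_sided_ideal L R \<and> (\<forall>n\<ge>1. pos_pow R x n \<notin> L)}"
  have "{\<zero>} \<in> F"
    using nil nil_ideal_zero by (auto simp: F_def nil_ideal_def)
  moreover have "\<Union>C \<in> F" if C: "C \<noteq> {}" "subset.chain F C" for C
  proof -
    have "two_sided_ideal (\<Union>C) R"
      using C by (intro two_sided_ideal_chain_Union) (auto simp: subset_chain_def F_def)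
    then show ?thesis using C by (auto simp: F_def subset_chain_def)
  qed
  ultimately obtain P where P: "P \<in> F" and max: "\<And>L. L \<in> F \<Longrightarrow> P \<subseteq> L \<Longrightarrow> L = P"
    using subset_Zorn_nonempty[of F] by (metis empty_iff)
  have I: "two_sided_ideal P R" and npow: "\<And>n. n \<ge> 1 \<Longrightarrow> pos_pow R x n \<notin> P"
    using P by (auto simp: F_def)
  note D = two_sided_idealD[OF I]
  have xP: "x \<notin> P" using npow[of 1] by (simp add: pos_pow_1)
  \<comment> \<open>By maximality, the sum of \<open>P\<close> with any ideal not inside
    \<open>P\<close> contains a power of \<open>x\<close>. Two such ideals with product in
    \<open>P\<close> would put a product of two powers of \<open>x\<close> into
    \<open>P\<close>.\<close>
  have hit: "\<exists>n\<ge>1. \<exists>p\<in>P. \<exists>l\<in>L. pos_pow R x n = p \<oplus> l"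
    if L: "two_sided_ideal L R" and nsub: "\<not> L \<subseteq> P" for L
  proof -
    note DL = two_sided_idealD[OF L]
    have "P \<subseteq> set_add R P L"
    proof
      fix p assume "p \<in> P"
      then have "p = p \<oplus> \<zero>" using D(2) by auto
      then show "p \<in> set_add R P L" using \<open>p \<in> P\<close> DL(3) by (auto simp: set_add_def')
    qed
    moreover have "L \<subseteq> set_add R P L"
    proof
      fix l assume "l \<in> L"
      then have "l = \<zero> \<oplus> l" using DL(2) by auto
      then show "l \<in> set_add R P L" using \<open>l \<in> L\<close> D(3) by (auto simp: set_add_def')
    qed
    ultimately have "set_add R P L \<notin> F" using max nsub by blast
    then show ?thesis
      using two_sided_ideal_sum[OF I L] by (auto simp: F_def set_add_def')
  qed
  have "prime_ideal P R"
  proof (rule prime_idealI[OF I])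
    show "P \<noteq> carrier R" using x xP by auto
    fix L L'
    assume L: "two_sided_ideal L R" "two_sided_ideal L' R" and
      prod: "\<And>y z. y \<in> L \<Longrightarrow> z \<in> L' \<Longrightarrow> y \<otimes> z \<in> P"
    show "L \<subseteq> P \<or> L' \<subseteq> P"
    proof (rule ccontr)
      assume "\<not> (L \<subseteq> P \<or> L' \<subseteq> P)"
      then obtain n p l n' p' l' where
        n: "n \<ge> 1" "p \<in> P" "l \<in> L" "pos_pow R x n = p \<oplus> l" and
        n': "n' \<ge> 1" "p' \<in> P" "l' \<in> L'" "pos_pow R x n' = p' \<oplus> l'"
        using hit L by meson
      have c: "p \<in> carrier R" "l \<in> carrier R" "p' \<in> carrier R" "l' \<in> carrier R"
        using n n' D(2) two_sided_idealD(2)[OF L(1)] two_sided_idealD(2)[OF L(2)] by auto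
      have "pos_pow R x (n + n') = (p \<oplus> l) \<otimes> (p' \<oplus> l')"
        using n n' x by (simp add: pos_pow_add)
      also have "\<dots> = p \<otimes> (p' \<oplus> l') \<oplus> (l \<otimes> p' \<oplus> l \<otimes> l')"
        using c by (simp add: distrib_l distrib_r mult_closed a_ac)
      also have "\<dots> \<in> P"
      proof -
        have "p \<otimes> (p' \<oplus> l') \<in> P" using n(2) c by (intro D(7)) auto
        moreover have "l \<otimes> p' \<in> P" using n'(2) c by (intro D(6))
        moreover have "l \<otimes> l' \<in> P" using n(3) n'(3) by (rule prod)
        ultimately show ?thesis by (intro D(4))
      qed
      finally show False using npow[of "n + n'"] n(1) by simp
    qed
  qed
  with xP show ?thesis using that by blast
qed

lemma nil_ideal_lower_nilradical: "nil_ideal (lower_nilradical R) R"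
  unfolding nil_ideal_def
proof (intro conjI ballI)
  show "two_sided_ideal (lower_nilradical R) R"
    using two_sided_idealD[OF prime_idealD(1)]
    by (intro two_sided_idealI)
       (auto simp: lower_nilradical_def semiprime_closure_def mult_closed)
  fix x assume x: "x \<in> lower_nilradical R"
  show "\<exists>n\<ge>1. pos_pow R x n = \<zero>"
  proof (rule ccontr)
    assume "\<not> (\<exists>n\<ge>1. pos_pow R x n = \<zero>)"
    moreover have "x \<in> carrier R" using x by (simp add: lower_nilradical_def semiprime_closure_def)
    ultimately obtain P where P: "prime_ideal P R" "x \<notin> P"
      using exists_prime_ideal_avoiding_powers by blast
    then have "{\<zero>} \<subseteq> P" using two_sided_idealD(3)[OF prime_idealD(1)] by blast
    then show False using x P by (auto simp: lower_nilradical_def semiprime_closure_def)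
  qed
qed

end


section \<open>Surjective homomorphisms\<close>

text \<open>Abstracts the quotient map, so that ideals are transferred without computing with
  cosets.\<close>

locale surjective_ring_hom = R: nonunital_ring R + S: nonunital_ring S
  for R (structure) and S (structure) +
  fixes h
  assumes surj: "h ` carrier R = carrier S"
    and hom_add: "x \<in> carrier R \<Longrightarrow> y \<in> carrier R \<Longrightarrow> h (x \<oplus>\<^bsub>R\<^esub> y) = h x \<oplus>\<^bsub>S\<^esub> h y"
    and hom_mult: "x \<in> carrier R \<Longrightarrow> y \<in> carrier R \<Longrightarrow> h (x \<otimes>\<^bsub>R\<^esub> y) = h x \<otimes>\<^bsub>S\<^esub> h y"
begin

lemma hom_closed [simp]: "x \<in> carrier R \<Longrightarrow> h x \<in> carrier S"
  using surj by auto

lemma hom_zero [simp]: "h \<zero>\<^bsub>R\<^esub> = \<zero>\<^bsub>S\<^esub>"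
  using hom_add[of "\<zero>\<^bsub>R\<^esub>" "\<zero>\<^bsub>R\<^esub>"] by simp

lemma hom_minus: "x \<in> carrier R \<Longrightarrow> h (\<ominus>\<^bsub>R\<^esub> x) = \<ominus>\<^bsub>S\<^esub> h x"
  by (rule S.minus_equality[symmetric]) (simp_all add: R.l_neg flip: hom_add)

lemma hom_pos_pow:
  assumes "n \<ge> 1" "x \<in> carrier R"
  shows "h (pos_pow R x n) = pos_pow S (h x) n"
  using assms by (induction n rule: dec_induct)
    (auto simp: pos_pow_1 pos_pow_Suc hom_mult R.pos_pow_closed)

lemma two_sided_ideal_vimage:
  assumes "two_sided_ideal L S"
  shows "two_sided_ideal {x \<in> carrier R. h x \<in> L} R"
  using S.two_sided_idealD[OF assms]
  by (intro R.two_sided_idealI) (auto simp: hom_add hom_mult hom_minus R.mult_closed)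

lemma two_sided_ideal_image:
  assumes "two_sided_ideal L R"
  shows "two_sided_ideal (h ` L) S"
proof (intro S.two_sided_idealI)
  note D = R.two_sided_idealD[OF assms]
  have c: "x \<in> carrier R" if "x \<in> L" for x using D(2) that by auto
  show "h ` L \<subseteq> carrier S" "\<zero>\<^bsub>S\<^esub> \<in> h ` L"
    using c D(3) hom_zero by (auto simp del: hom_zero) (metis hom_zero imageI)
  show "x \<oplus>\<^bsub>S\<^esub> y \<in> h ` L" if "x \<in> h ` L" "y \<in> h ` L" for x y
    using that D(4) c by (auto simp flip: hom_add)
  show "\<ominus>\<^bsub>S\<^esub> x \<in> h ` L" if "x \<in> h ` L" for x
    using that D(5) c by (auto simp flip: hom_minus)
  fix a x assume "a \<in> carrier S" "x \<in> h ` L"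
  then obtain b y where "b \<in> carrier R" "a = h b" "y \<in> L" "x = h y"
    unfolding surj[symmetric] by auto
  with c D(6,7) show "a \<otimes>\<^bsub>S\<^esub> x \<in> h ` L" "x \<otimes>\<^bsub>S\<^esub> a \<in> h ` L"
    by (simp_all flip: hom_mult)
qed

lemma prime_ideal_vimage:
  assumes P: "prime_ideal P S"
  shows "prime_ideal {x \<in> carrier R. h x \<in> P} R"
proof (rule R.prime_idealI)
  note D = S.prime_idealD[OF P]
  show "two_sided_ideal {x \<in> carrier R. h x \<in> P} R"
    by (rule two_sided_ideal_vimage[OF D(1)])
  show "{x \<in> carrier R. h x \<in> P} \<noteq> carrier R"
  proof
    assume "{x \<in> carrier R. h x \<in> P} = carrier R"
    then have "carrier S \<subseteq> P" unfolding surj[symmetric] by blast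
    then show False using D(2) S.two_sided_idealD(2)[OF D(1)] by blast
  qed
  fix L L'
  assume L: "two_sided_ideal L R" "two_sided_ideal L' R"
    and prod: "\<And>x y. x \<in> L \<Longrightarrow> y \<in> L' \<Longrightarrow> x \<otimes>\<^bsub>R\<^esub> y \<in> {x \<in> carrier R. h x \<in> P}"
  have c: "L \<subseteq> carrier R" "L' \<subseteq> carrier R" using L R.two_sided_idealD(2) by auto
  have "h ` L \<subseteq> P \<or> h ` L' \<subseteq> P"
    by (rule D(3)[OF two_sided_ideal_image[OF L(1)] two_sided_ideal_image[OF L(2)]])
       (use prod c in \<open>auto simp: subset_iff simp flip: hom_mult\<close>)
  then show "L \<subseteq> {x \<in> carrier R. h x \<in> P} \<or> L' \<subseteq> {x \<in> carrier R. h x \<in> P}"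
    using c by blast
qed

text \<open>The preimage of the upper nilradical is radical over the kernel of \<open>h\<close>. By
  \<open>rad\<close> it lies in every prime ideal above the kernel, in particular in the preimage of
  each prime ideal of \<open>S\<close>.\<close>

lemma upper_nilradical_le_lower_nilradical:
  assumes rad: "\<And>J. left_ideal J R \<Longrightarrow> radical_over R J {x \<in> carrier R. h x = \<zero>\<^bsub>S\<^esub>} \<Longrightarrow>
      J \<subseteq> semiprime_closure R {x \<in> carrier R. h x = \<zero>\<^bsub>S\<^esub>}"
  shows "upper_nilradical S \<subseteq> lower_nilradical S"
proof
  fix y assume y: "y \<in> upper_nilradical S"
  have N: "two_sided_ideal (upper_nilradical S) S"
    "\<And>z. z \<in> upper_nilradical S \<Longrightarrow> \<exists>n\<ge>1. pos_pow S z n = \<zero>\<^bsub>S\<^esub>"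
    using S.upper_nilradical_greatest(1) by (auto simp: nil_ideal_def)
  define J where "J = {x \<in> carrier R. h x \<in> upper_nilradical S}"
  have "left_ideal J R"
    unfolding J_def using two_sided_ideal_vimage[OF N(1)] by (simp add: two_sided_ideal_def)
  moreover have "radical_over R J {x \<in> carrier R. h x = \<zero>\<^bsub>S\<^esub>}"
    unfolding radical_over_def
  proof
    fix x assume "x \<in> J"
    then have "x \<in> carrier R" "\<exists>n\<ge>1. pos_pow S (h x) n = \<zero>\<^bsub>S\<^esub>" using N(2) by (auto simp: J_def)
    then show "\<exists>n\<ge>1. pos_pow R x n \<in> {x \<in> carrier R. h x = \<zero>\<^bsub>S\<^esub>}"
      by (auto simp: hom_pos_pow R.pos_pow_closed)
  qed
  ultimately have J: "J \<subseteq> semiprime_closure R {x \<in> carrier R. h x = \<zero>\<^bsub>S\<^esub>}" by (rule rad)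
  have yS: "y \<in> carrier S" using y S.two_sided_idealD(2)[OF N(1)] by auto
  then obtain x where x: "x \<in> carrier R" "y = h x" unfolding surj[symmetric] by auto
  have "y \<in> P" if P: "prime_ideal P S" "\<zero>\<^bsub>S\<^esub> \<in> P" for P
  proof -
    have "{x \<in> carrier R. h x = \<zero>\<^bsub>S\<^esub>} \<subseteq> {x \<in> carrier R. h x \<in> P}" using P(2) by auto
    then have "J \<subseteq> {x \<in> carrier R. h x \<in> P}"
      using J prime_ideal_vimage[OF P(1)] unfolding semiprime_closure_def by blast
    then show ?thesis using x y by (auto simp: J_def)
  qed
  then show "y \<in> lower_nilradical S"
    using yS by (auto simp: lower_nilradical_def semiprime_closure_def)
qed

end

lemma (in nonunital_ring) surjective_ring_hom_quotient:
  assumes I: "two_sided_ideal I R"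
  shows "surjective_ring_hom R (R Quot I) (\<lambda>x. I +> x)"
    and "{x \<in> carrier R. I +> x = \<zero>\<^bsub>R Quot I\<^esub>} = I"
proof -
  note D = two_sided_idealD[OF I]
  interpret abelian_subgroup I R
    by (intro abelian_subgroupI3 D abelian_group_axioms)
  show "surjective_ring_hom R (R Quot I) (\<lambda>x. I +> x)"
    by (intro surjective_ring_hom.intro surjective_ring_hom_axioms.intro nonunital_ring_axioms
        nonunital_ring_quotient I quotient_mult[symmetric])
       (auto simp: FactRing_def A_RCOSETS_def' a_rcos_sum)
  show "{x \<in> carrier R. I +> x = \<zero>\<^bsub>R Quot I\<^esub>} = I"
    using D(2) a_rcos_self a_rcos_const by (auto simp: FactRing_def)
qed


section \<open>Ideals of C*-algebras\<close>

lemma type_ring_simps [simp]: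
  "carrier type_ring = UNIV" "x \<otimes>\<^bsub>type_ring\<^esub> y = x * y" "x \<oplus>\<^bsub>type_ring\<^esub> y = x + y"
  "\<zero>\<^bsub>type_ring\<^esub> = 0"
  by (simp_all add: type_ring_def)

lemma Unitization_pos_pow:
  fixes x :: "'a::cstar_algebra"
  assumes "n \<ge> 1"
  shows "Unitization (pos_pow type_ring x n) 0 = Unitization x 0 ^ n"
  using assms
proof (induction n rule: dec_induct)
  case (step n)
  have "Unitization (pos_pow type_ring x (Suc n)) 0 =
      Unitization (pos_pow type_ring x n) 0 * Unitization x 0"
    using step.hyps by (auto intro!: unitization.expand simp: pos_pow_Suc)
  then show ?case by (simp only: step.IH power_Suc2)
qed (simp add: pos_pow_1)

text \<open>The elements multiplying the whole algebra into \<open>P\<close> extend \<open>P\<close>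
  to the unitization: this set meets the original algebra exactly in \<open>P\<close> by right
  cancellation. It thus makes the results on unital algebras applicable.\<close>

lemma semiprime_ideal_unitization:
  fixes P :: "'a::cstar_algebra set"
  assumes P: "prime_ideal P type_ring"
  shows "semiprime_ideal {u. \<forall>a. umult u a \<in> P}"
    and "Unitization x 0 \<in> {u. \<forall>a. umult u a \<in> P} \<longleftrightarrow> x \<in> P"
proof -
  interpret nonunital_ring "type_ring :: 'a ring" by (rule nonunital_ring_type_ring)
  have D: "x \<in> P \<Longrightarrow> y \<in> P \<Longrightarrow> x + y \<in> P" "x \<in> P \<Longrightarrow> a * x \<in> P" "x \<in> P \<Longrightarrow> x * a \<in> P" for x y a
    using two_sided_idealD[OF prime_idealD(1)[OF P]] by simp_all
  \<comment> \<open>Ideals are only additive subgroups, but a prime one absorbs complex scalars: in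
    \<open>a * scaleC c x\<close> the scalar can be moved to \<open>a\<close>, and left cancellation
    applies.\<close>
  have sc: "scaleC c x \<in> P" if x: "x \<in> P" for c x
  proof (rule prime_ideal_left_cancel[OF P])
    fix a
    have "a * scaleC c x = scaleC c a * x" by (simp add: mult_scaleC_left mult_scaleC_right)
    then show "a \<otimes>\<^bsub>type_ring\<^esub> scaleC c x \<in> P" using D(2)[OF x] by simp
  qed simp
  have assoc: "umult u y * z = umult u (y * z)" for u :: "'a unitization" and y z
    by (simp add: umult_def algebra_simps mult_scaleC_left)
  show "semiprime_ideal {u. \<forall>a. umult u a \<in> P}"
  proof
    fix u v :: "'a unitization"
    assume u: "u \<in> {u. \<forall>a. umult u a \<in> P}"
    show "u * v \<in> {u. \<forall>a. umult u a \<in> P}" using u by (simp add: umult_mult)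
    show "v * u \<in> {u. \<forall>a. umult u a \<in> P}"
      using u by (simp add: umult_mult umult_def[of v] D sc)
    assume v: "v \<in> {u. \<forall>a. umult u a \<in> P}"
    have "umult (u + v) a = umult u a + umult v a" for a
      by (simp add: umult_def algebra_simps scaleC_add_left)
    then show "u + v \<in> {u. \<forall>a. umult u a \<in> P}" using u v by (simp add: D)
  next
    fix u :: "'a unitization"
    assume u: "\<And>b. u * b * u \<in> {u. \<forall>a. umult u a \<in> P}"
    have "umult u a \<in> P" for a
    proof (rule prime_ideal_semiprime[OF P])
      fix b
      \<comment> \<open>The middle factor \<open>a * b\<close> is embedded in the unitization, so
        the hypothesis on \<open>u * b * u\<close> reduces to semiprimeness of \<open>P\<close> at
        \<open>umult u a\<close>.\<close>
      have "umult u a * b * umult u a = umult (u * Unitization (a * b) 0 * u) a"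
        by (simp only: assoc umult_mult) (simp add: umult_def[of "Unitization _ _"])
      then show "umult u a \<otimes>\<^bsub>type_ring\<^esub> b \<otimes>\<^bsub>type_ring\<^esub> umult u a \<in> P" using u by simp
    qed simp
    then show "u \<in> {u. \<forall>a. umult u a \<in> P}" by simp
  qed
  have "umult (Unitization x 0) a = x * a" for a by (simp add: umult_def)
  then show "Unitization x 0 \<in> {u. \<forall>a. umult u a \<in> P} \<longleftrightarrow> x \<in> P"
    using D(3) prime_ideal_right_cancel[OF P, of x] by auto
qed

lemma prime_ideal_star_mult:
  fixes P :: "'a::cstar_algebra set"
  assumes P: "prime_ideal P type_ring" and n: "n \<ge> 1"
  shows "pos_pow type_ring (star x * x) n \<in> P \<Longrightarrow> x \<in> P"
    and "pos_pow type_ring (x * star x) n \<in> P \<Longrightarrow> x \<in> P"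
proof -
  let ?Q = "{u. \<forall>a. umult u a \<in> P}"
  interpret semiprime_ideal ?Q by (rule semiprime_ideal_unitization[OF P])
  have star: "Unitization (star x * x) 0 = star (Unitization x 0) * Unitization x 0"
    "Unitization (x * star x) 0 = Unitization x 0 * star (Unitization x 0)"
    by (auto intro: unitization.expand)
  note iff = semiprime_ideal_unitization(2)[OF P]
  show "x \<in> P" if "pos_pow type_ring (star x * x) n \<in> P"
    using power_star_mult_imp[OF n, of "Unitization x 0"] that
    by (simp only: iff flip: star Unitization_pos_pow[OF n])
  show "x \<in> P" if "pos_pow type_ring (x * star x) n \<in> P"
    using power_mult_star_imp[OF n, of "Unitization x 0"] that
    by (simp only: iff flip: star Unitization_pos_pow[OF n])
qed

lemma one_sided_radical_subset_semiprime_closure: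
  fixes I :: "'a::cstar_algebra set"
  assumes J: "left_ideal J type_ring \<or> right_ideal J type_ring"
    and rad: "radical_over type_ring J I"
  shows "J \<subseteq> semiprime_closure type_ring I"
proof
  fix x assume x: "x \<in> J"
  have "x \<in> P" if P: "prime_ideal P type_ring" "I \<subseteq> P" for P
  proof -
    \<comment> \<open>A left ideal contains \<open>star x * x\<close>, a right ideal
      \<open>x * star x\<close>; only one of the two alternatives is available.\<close>
    from J x have "star x * x \<in> J \<or> x * star x \<in> J"
      by (auto simp: left_ideal_def right_ideal_def)
    with rad P(2) obtain n where "n \<ge> 1"
      "pos_pow type_ring (star x * x) n \<in> P \<or> pos_pow type_ring (x * star x) n \<in> P"
      unfolding radical_over_def by blast
    then show ?thesis using prime_ideal_star_mult[OF P(1)] by blast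
  qed
  then show "x \<in> semiprime_closure type_ring I" by (auto simp: semiprime_closure_def)
qed

theorem corollary5p10:
  fixes I :: "'a::cstar_algebra set"
  assumes "two_sided_ideal I (type_ring :: 'a ring)"
  shows "(\<forall>J. (left_ideal J (type_ring :: 'a ring) \<or> right_ideal J (type_ring :: 'a ring)) \<and>
              radical_over (type_ring :: 'a ring) J I \<longrightarrow>
            J \<subseteq> semiprime_closure (type_ring :: 'a ring) I) \<and>
         lower_nilradical ((type_ring :: 'a ring) Quot I) =
         upper_nilradical ((type_ring :: 'a ring) Quot I)"
proof (intro conjI allI impI)
  show "J \<subseteq> semiprime_closure type_ring I"
    if "(left_ideal J (type_ring :: 'a ring) \<or> right_ideal J type_ring) \<and> radical_over type_ring J I" for J
    using that one_sided_radical_subset_semiprime_closure by blast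
  interpret nonunital_ring "type_ring :: 'a ring" by (rule nonunital_ring_type_ring)
  interpret surjective_ring_hom "type_ring :: 'a ring" "type_ring Quot I" "\<lambda>x. I +>\<^bsub>type_ring\<^esub> x"
    by (rule surjective_ring_hom_quotient[OF assms])
  show "lower_nilradical (type_ring Quot I) = upper_nilradical (type_ring Quot I)"
  proof
    show "lower_nilradical (type_ring Quot I) \<subseteq> upper_nilradical (type_ring Quot I)"
      by (rule S.upper_nilradical_greatest(2)[OF S.nil_ideal_lower_nilradical])
    show "upper_nilradical (type_ring Quot I) \<subseteq> lower_nilradical (type_ring Quot I)"
    proof (rule upper_nilradical_le_lower_nilradical,
        unfold surjective_ring_hom_quotient(2)[OF assms])
      show "J \<subseteq> semiprime_closure type_ring I"
        if "left_ideal J type_ring" "radical_over type_ring J I" for J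
        using that one_sided_radical_subset_semiprime_closure by blast
    qed
  qed
qed

end
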